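(* Suppose the fine structure assumption, (for every $k\in\mathcal I$) the coarse structure assumption and the nonsmooth primal-dual coherence condition, and the parameter assumption stated in the context hold. Then for any initial $u^0\in U$ the iterates generated by the PDMCC algorithm satisfy, for any $\hat u\in\hat U:=[\partial\bar G+\nabla\bar E+\Xi]^{-1}(0)$ and $N\ge1$, the ergodic gap estimate $$\mathcal G_L(\tilde u^N;\hat u)\le\frac{\varepsilon\kappa_\varepsilon+1}{2N}\big[\|u^0-\hat u\|_M^2+\rho\big]\quad\text{where}\quad\tilde u^N:=\frac1N\sum_{k=0}^{N-1}u^{k+1}.$$ In particular, for every $\hat u\in\hat U$, $\mathcal G_L(\tilde u^N;\hat u)\to0$ at the rate $O(1/N)$ as $N\to\infty$.
   Context: $\mathbb L(A;B)$ denotes the bounded linear operators from $A$ to $B$; $\overline{\mathbb R}=[-\infty,+\infty]$; $\partial$ is the convex subdifferential, $(\cdot)^*$ on functions is the Fenchel conjugate and on operators the adjoint; $f'(u;d)$ is the (one-sided) directional derivative; $\|u\|_A:=\sqrt{\langle Au,u\rangle}$ for self-adjoint positive semi-definite $A$. Fine structure assumption: $X,Y$ are Hilbert spaces, $U=X\times Y$; $F,E:X\to\overline{\mathbb R}$ and $G:Y\to\overline{\mathbb R}$ are proper, convex and lower semicontinuous, $E$ is differentiable on $X$ with $L$-Lipschitz gradient, $K\in\mathbb L(X;Y)$, and $\tau,\sigma>0$ satisfy $\tau L+\tau\sigma\|K\|^2<1$. For $u=(x,y)\in U$: $\bar G(u):=F(x)+G^*(y)$, $\bar E(u):=E(x)$,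 $$M=\begin{pmatrix}\tau^{-1}\mathrm{Id}&-K^*\\-K&\sigma^{-1}\mathrm{Id}\end{pmatrix},\ \Xi=\begin{pmatrix}0&K^*\\-K&0\end{pmatrix},\ \Lambda=\begin{pmatrix}L\,\mathrm{Id}&0\\0&0\end{pmatrix},\ Z=\begin{pmatrix}\tau^{-1}\mathrm{Id}&-2K^*\\0&\sigma^{-1}\mathrm{Id}\end{pmatrix},\ W=\frac1CZZ^*,$$ with $C:=(1-\sqrt{\tau\sigma}\|K\|)\min\{\tau^{-1},\sigma^{-1}\}>0$. Let $\Phi(u;\hat u):=\bar G(u)+\bar E(u)+\langle\Xi\hat u,u\rangle$; the Lagrangian gap is $\mathcal G_L(u;\hat u):=\Phi(u;\hat u)-\Phi(\hat u;\hat u)$. $\hat u\in[\partial\bar G+\nabla\bar E+\Xi]^{-1}(0)$ means $0\in\partial\bar G(\hat u)+\nabla\bar E(\hat u)+\Xi\hat u$ (primal-dual solutions of $\min_xF(x)+E(x)+G(Kx)$). Coarse objects: $X_H,Y_H$ are Hilbert spaces, $U_H=X_H\times Y_H$ with elements $v=(\zeta,\xi)$; $P_h^H\in\mathbb L(X;X_H)$, $D_h^H\in\mathbb L(Y;Y_H)$, $I_h^H(x,y):=(P_h^Hx,D_h^Hy)$, $I_H^h:=(I_h^H)^*$. Coarse structure assumption: $E_H:X_H\to\mathbb R$, $F_H^k:X_H\to\overline{\mathbb R}$, $G_H^k:Y_H\to\overline{\mathbb R}$ are proper, convex and lower semicontinuous, $E_H$ is differentiable with $L_H$-Lipschitz gradient,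 $K_H\in\mathbb L(X_H;Y_H)$, and $\tau_H,\sigma_H>0$ satisfy $\tau_HL_H+\tau_H\sigma_H\|K_H\|^2<1$. Write $\bar G_H^k(v):=F_H^k(\zeta)+(G_H^k)^*(\xi)$, $\bar E_H(v):=E_H(\zeta)$, $$M_H=\begin{pmatrix}\tau_H^{-1}\mathrm{Id}&-K_H^*\\-K_H&\sigma_H^{-1}\mathrm{Id}\end{pmatrix},\quad \Xi_H=\begin{pmatrix}0&K_H^*\\-K_H&0\end{pmatrix}.$$ Coherence condition (at $k$): $I_h^H\partial\bar G(u_+^k)\subset\partial\bar G_H^k(v^{k,0})$, where $v^{k,0}:=I_h^Hu_+^k$. Parameter assumption: $\{\varepsilon_k\}_{k\in\mathcal I},\{\rho_k\}_{k\in\mathcal I}\subset(0,\infty)$ satisfy $\sum_{k\in\mathcal I}\varepsilon_k=:\varepsilon<\infty$, $\sum_{k\in\mathcal I}\rho_k=:\rho<\infty$ and $\prod_{k\in\mathcal I}(1+\varepsilon_k)=:\kappa_\varepsilon<\infty$. PDMCC algorithm: fix $\kappa\in(0,1)$, $m\ge1$, $\vartheta\in\{0,1\}$ and a trigger condition; $\mathcal I\subset\mathbb N$ is the set of iterations at which the (arbitrary) trigger condition holds. From $u^0\in U$, for each $k\in\mathbb N$, with $u^k=(x^k,y^k)$: 1. $u_+^k=(x_+^k,y_+^k)$ with $x_+^k:=\mathrm{prox}_{\tau F}(x^k-\tau(\nabla E(x^k)+K^*y^k))$, $y_+^k:=\mathrm{prox}_{\sigma G^*}(y^k+\sigma K(2x_+^k-x^k))$.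 2. If $k\notin\mathcal I$, set $u^{k+1}:=u_+^k$. 3. If $k\in\mathcal I$: with $s_H^k:=I_h^H(\nabla\bar E(u_+^k)+\Xi u_+^k)-\nabla\bar E_H(v^{k,0})$, for $j=0,\ldots,m-1$ determine $v^{k,j+1}$ from $$0\in\partial\bar G_H^k(v^{k,j+1})+\Xi_H(v^{k,j+1}-v_\vartheta^j)+\nabla\bar E_H(v^{k,j})+s_H^k+M_H(v^{k,j+1}-v^{k,j}),\quad v_\vartheta^j:=(1-\vartheta)v^{k,j}+\vartheta v^{k,0};$$ let $\tilde v^{k,m}:=\frac1m\sum_{j=0}^{m-1}v^{k,j+1}$ if $\vartheta=1$, $\tilde v^{k,m}:=v^{k,m}$ if $\vartheta=0$; set $d^k:=I_H^h(\tilde v^{k,m}-v^{k,0})$ and $u^{k+1}:=u_+^k+\theta_kd^k$, where $\theta=\theta_k\ge0$ satisfies either $$\Phi^k(u_+^k+\theta d^k)+\tfrac12\|\theta d^k\|_M^2+\tfrac1{2\varepsilon_k}\|\theta d^k\|_W^2\le\Phi^k(u_+^k)+\kappa\theta[\Phi^k]'(u_+^k;d^k)+\tfrac{\rho_k}2$$ or $$\Psi^k(u_+^k+\theta d^k)+\tfrac12\|\theta d^k\|_{M+\Lambda}^2+\tfrac1{2\varepsilon_k}\|\theta d^k\|_W^2\le\Psi^k(u_+^k)+\kappa\theta[\Psi^k]'(u_+^k;d^k)+\tfrac{\rho_k}2,$$ with $\Phi^k(u):=\Phi(u;u_+^k)$ and $\Psi^k(u):=\bar G(u)+\bar E(u_+^k)+\langle\nabla\bar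 E(u_+^k),u-u_+^k\rangle+\langle\Xi u_+^k,u\rangle$. If $v^{k,0}$ already solves the coarse problem, i.e. $0\in\partial\bar G_H^k(v^{k,0})+\nabla\bar E_H(v^{k,0})+s_H^k$, the correction is rejected: $d^k=0$, $\theta_k=0$.
   Formalization: Added assumption: whenever k∈I and θ_k>0, the directional derivative Ḡ'(u_+^k;d^k) equals the supremum of ⟨g,d^k⟩ over g∈∂Ḡ(u_+^k); without it coherence need not make d^k a descent direction and the estimate can fail. *)

theory Defs
  imports "HOL-Analysis.Analysis" "HOL-Library.Landau_Symbols"
begin

text \<open>
  Real Hilbert spaces are types of sort \<open>{real_inner, complete_space}\<close>. Functions into the
  extended reals have values in \<^typ>\<open>ereal\<close>, where \<open>\<infinity> + (-\<infinity>) = \<infinity>\<close> and \<open>0 * (\<plusminus>\<infinity>) = 0\<close>.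
\<close>

section \<open>Convex analysis\<close>

definition proper :: "('a \<Rightarrow> ereal) \<Rightarrow> bool" where
  "proper f \<longleftrightarrow> (\<forall>x. f x \<noteq> -\<infinity>) \<and> (\<exists>x. f x \<noteq> \<infinity>)"

definition econvex :: "('a::real_vector \<Rightarrow> ereal) \<Rightarrow> bool" where
  "econvex f \<longleftrightarrow> (\<forall>x y. \<forall>t\<in>{0<..<1}.
     f ((1 - t) *\<^sub>R x + t *\<^sub>R y) \<le> ereal (1 - t) * f x + ereal t * f y)"

definition lsc :: "('a::topological_space \<Rightarrow> ereal) \<Rightarrow> bool" where
  "lsc f \<longleftrightarrow> (\<forall>x. f x \<le> Liminf (at x) f)"

definition proper_convex_lsc :: "('a::real_normed_vector \<Rightarrow> ereal) \<Rightarrow> bool" where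
  "proper_convex_lsc f \<longleftrightarrow> proper f \<and> econvex f \<and> lsc f"

text \<open>The subdifferential is empty outside the effective domain.\<close>

definition subdiff :: "('a::real_inner \<Rightarrow> ereal) \<Rightarrow> 'a \<Rightarrow> 'a set" where
  "subdiff f x = {g. \<bar>f x\<bar> \<noteq> \<infinity> \<and> (\<forall>z. f x + ereal (inner g (z - x)) \<le> f z)}"

definition fenchel_conj :: "('a::real_inner \<Rightarrow> ereal) \<Rightarrow> 'a \<Rightarrow> ereal" where
  "fenchel_conj f y = (SUP x. ereal (inner y x) - f x)"

definition prox :: "('a::real_inner \<Rightarrow> ereal) \<Rightarrow> 'a \<Rightarrow> 'a" where
  "prox f x = arg_min (\<lambda>z. f z + ereal ((norm (z - x))\<^sup>2 / 2)) (\<lambda>_. True)"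

text \<open>
  The one-sided directional derivative, as a limit in the extended reals. It is only used at points
  where \<open>f\<close> is finite; for convex \<open>f\<close> the limit exists there.
\<close>

definition dirderiv :: "('a::real_vector \<Rightarrow> ereal) \<Rightarrow> 'a \<Rightarrow> 'a \<Rightarrow> ereal" where
  "dirderiv f u d = Lim (at_right 0) (\<lambda>t::real. (f (u + t *\<^sub>R d) - f u) / ereal t)"

definition grad :: "('a::real_inner \<Rightarrow> real) \<Rightarrow> 'a \<Rightarrow> 'a" where
  "grad f x = (THE g. GDERIV f x :> g)"


section \<open>Operators\<close>

abbreviation badjoint :: "('a::real_inner \<Rightarrow>\<^sub>L 'b::real_inner) \<Rightarrow> 'b \<Rightarrow> 'a" where
  "badjoint K \<equiv> adjoint (blinfun_apply K)"

definition op_norm :: "('a::real_inner \<Rightarrow> 'a) \<Rightarrow> 'a \<Rightarrow> real" where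
  "op_norm A u = sqrt (inner (A u) u)"

definition block_op ::
  "('a \<Rightarrow> 'c::plus) \<Rightarrow> ('b \<Rightarrow> 'c) \<Rightarrow> ('a \<Rightarrow> 'd::plus) \<Rightarrow> ('b \<Rightarrow> 'd) \<Rightarrow> 'a \<times> 'b \<Rightarrow> 'c \<times> 'd" where
  "block_op A B C D u = (A (fst u) + B (snd u), C (fst u) + D (snd u))"

definition M_op :: "real \<Rightarrow> real \<Rightarrow> ('x::real_inner \<Rightarrow>\<^sub>L 'y::real_inner) \<Rightarrow> 'x \<times> 'y \<Rightarrow> 'x \<times> 'y" where
  "M_op \<tau> \<sigma> K = block_op
     (\<lambda>x. inverse \<tau> *\<^sub>R x) (\<lambda>y. - badjoint K y)
     (\<lambda>x. - blinfun_apply K x) (\<lambda>y. inverse \<sigma> *\<^sub>R y)"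

definition Xi_op :: "('x::real_inner \<Rightarrow>\<^sub>L 'y::real_inner) \<Rightarrow> 'x \<times> 'y \<Rightarrow> 'x \<times> 'y" where
  "Xi_op K = block_op
     (\<lambda>x. 0) (\<lambda>y. badjoint K y)
     (\<lambda>x. - blinfun_apply K x) (\<lambda>y. 0)"

definition Lambda_op :: "real \<Rightarrow> 'x::real_inner \<times> 'y::real_inner \<Rightarrow> 'x \<times> 'y" where
  "Lambda_op L = block_op
     (\<lambda>x. L *\<^sub>R x) (\<lambda>y. 0)
     (\<lambda>x. 0) (\<lambda>y. 0)"

definition Z_op :: "real \<Rightarrow> real \<Rightarrow> ('x::real_inner \<Rightarrow>\<^sub>L 'y::real_inner) \<Rightarrow> 'x \<times> 'y \<Rightarrow> 'x \<times> 'y" where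
  "Z_op \<tau> \<sigma> K = block_op
     (\<lambda>x. inverse \<tau> *\<^sub>R x) (\<lambda>y. - (2 *\<^sub>R badjoint K y))
     (\<lambda>x. 0) (\<lambda>y. inverse \<sigma> *\<^sub>R y)"

definition C_const :: "real \<Rightarrow> real \<Rightarrow> ('x::real_inner \<Rightarrow>\<^sub>L 'y::real_inner) \<Rightarrow> real" where
  "C_const \<tau> \<sigma> K = (1 - sqrt (\<tau> * \<sigma>) * norm K) * min (inverse \<tau>) (inverse \<sigma>)"

definition W_op :: "real \<Rightarrow> real \<Rightarrow> ('x::real_inner \<Rightarrow>\<^sub>L 'y::real_inner) \<Rightarrow> 'x \<times> 'y \<Rightarrow> 'x \<times> 'y" where
  "W_op \<tau> \<sigma> K u = (1 / C_const \<tau> \<sigma> K) *\<^sub>R Z_op \<tau> \<sigma> K (adjoint (Z_op \<tau> \<sigma> K) u)"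


section \<open>Saddle point problem and Lagrangian gap\<close>

text \<open>
  The same definitions serve the fine and the coarse level. The smooth term \<open>E\<close> is
  everywhere differentiable, hence finite, and therefore real-valued.
\<close>

definition structure_assumption ::
  "('x::real_inner \<Rightarrow> ereal) \<Rightarrow> ('x \<Rightarrow> real) \<Rightarrow> ('y::real_inner \<Rightarrow> ereal) \<Rightarrow> ('x \<Rightarrow>\<^sub>L 'y)
     \<Rightarrow> real \<Rightarrow> real \<Rightarrow> real \<Rightarrow> bool" where
  "structure_assumption F E G K \<tau> \<sigma> L \<longleftrightarrow>
     proper_convex_lsc F \<and> proper_convex_lsc (\<lambda>x. ereal (E x)) \<and> proper_convex_lsc G \<and>
     E differentiable_on UNIV \<and> L-lipschitz_on UNIV (grad E) \<and>
     \<tau> > 0 \<and> \<sigma> > 0 \<and> \<tau> * L + \<tau> * \<sigma> * (norm K)\<^sup>2 < 1"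

definition Gbar ::
  "('x::real_inner \<Rightarrow> ereal) \<Rightarrow> ('y::real_inner \<Rightarrow> ereal) \<Rightarrow> 'x \<times> 'y \<Rightarrow> ereal" where
  "Gbar F G u = F (fst u) + fenchel_conj G (snd u)"

definition Ebar :: "('x::real_inner \<Rightarrow> real) \<Rightarrow> 'x \<times> 'y::real_inner \<Rightarrow> real" where
  "Ebar E u = E (fst u)"

definition Phi ::
  "('x::real_inner \<Rightarrow> ereal) \<Rightarrow> ('x \<Rightarrow> real) \<Rightarrow> ('y::real_inner \<Rightarrow> ereal) \<Rightarrow> ('x \<Rightarrow>\<^sub>L 'y)
     \<Rightarrow> 'x \<times> 'y \<Rightarrow> 'x \<times> 'y \<Rightarrow> ereal" where
  "Phi F E G K u w = Gbar F G u + ereal (Ebar E u) + ereal (inner (Xi_op K w) u)"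

definition Psi ::
  "('x::real_inner \<Rightarrow> ereal) \<Rightarrow> ('x \<Rightarrow> real) \<Rightarrow> ('y::real_inner \<Rightarrow> ereal) \<Rightarrow> ('x \<Rightarrow>\<^sub>L 'y)
     \<Rightarrow> 'x \<times> 'y \<Rightarrow> 'x \<times> 'y \<Rightarrow> ereal" where
  "Psi F E G K u w = Gbar F G u + ereal (Ebar E w) + ereal (inner (grad (Ebar E) w) (u - w))
     + ereal (inner (Xi_op K w) u)"

definition lagrangian_gap ::
  "('x::real_inner \<Rightarrow> ereal) \<Rightarrow> ('x \<Rightarrow> real) \<Rightarrow> ('y::real_inner \<Rightarrow> ereal) \<Rightarrow> ('x \<Rightarrow>\<^sub>L 'y)
     \<Rightarrow> 'x \<times> 'y \<Rightarrow> 'x \<times> 'y \<Rightarrow> ereal" where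
  "lagrangian_gap F E G K u w = Phi F E G K u w - Phi F E G K w w"

definition primal_dual_solutions ::
  "('x::real_inner \<Rightarrow> ereal) \<Rightarrow> ('x \<Rightarrow> real) \<Rightarrow> ('y::real_inner \<Rightarrow> ereal) \<Rightarrow> ('x \<Rightarrow>\<^sub>L 'y)
     \<Rightarrow> ('x \<times> 'y) set" where
  "primal_dual_solutions F E G K =
     {u. 0 \<in> (\<lambda>g. g + grad (Ebar E) u + Xi_op K u) ` subdiff (Gbar F G) u}"


section \<open>The algorithm\<close>

definition pd_step ::
  "('x::real_inner \<Rightarrow> ereal) \<Rightarrow> ('x \<Rightarrow> real) \<Rightarrow> ('y::real_inner \<Rightarrow> ereal) \<Rightarrow> ('x \<Rightarrow>\<^sub>L 'y)
     \<Rightarrow> real \<Rightarrow> real \<Rightarrow> 'x \<times> 'y \<Rightarrow> 'x \<times> 'y" where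
  "pd_step F E G K \<tau> \<sigma> u =
     (let x = fst u; y = snd u;
          x' = prox (\<lambda>z. ereal \<tau> * F z) (x - \<tau> *\<^sub>R (grad E x + badjoint K y));
          y' = prox (\<lambda>z. ereal \<sigma> * fenchel_conj G z)
                 (y + \<sigma> *\<^sub>R blinfun_apply K (2 *\<^sub>R x' - x))
      in (x', y'))"

definition restriction ::
  "('x::real_inner \<Rightarrow>\<^sub>L 'a::real_inner) \<Rightarrow> ('y::real_inner \<Rightarrow>\<^sub>L 'b::real_inner) \<Rightarrow> 'x \<times> 'y \<Rightarrow> 'a \<times> 'b" where
  "restriction P D u = (blinfun_apply P (fst u), blinfun_apply D (snd u))"

definition prolongation ::
  "('x::real_inner \<Rightarrow>\<^sub>L 'a::real_inner) \<Rightarrow> ('y::real_inner \<Rightarrow>\<^sub>L 'b::real_inner) \<Rightarrow> 'a \<times> 'b \<Rightarrow> 'x \<times> 'y" where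
  "prolongation P D = adjoint (restriction P D)"

definition coherent ::
  "('x::real_inner \<Rightarrow> ereal) \<Rightarrow> ('y::real_inner \<Rightarrow> ereal)
     \<Rightarrow> ('x \<Rightarrow>\<^sub>L 'a::real_inner) \<Rightarrow> ('y \<Rightarrow>\<^sub>L 'b::real_inner)
     \<Rightarrow> ('a \<Rightarrow> ereal) \<Rightarrow> ('b \<Rightarrow> ereal) \<Rightarrow> 'x \<times> 'y \<Rightarrow> bool" where
  "coherent F G P D FH GH u \<longleftrightarrow>
     restriction P D ` subdiff (Gbar F G) u \<subseteq> subdiff (Gbar FH GH) (restriction P D u)"

text \<open>The shift \<open>s\<^sub>H\<close> that makes the coarse and fine problems first-order consistent at \<open>u\<close>.\<close>

definition coarse_shift ::
  "('x::real_inner \<Rightarrow> real) \<Rightarrow> ('x \<Rightarrow>\<^sub>L 'y::real_inner)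
     \<Rightarrow> ('x \<Rightarrow>\<^sub>L 'a::real_inner) \<Rightarrow> ('y \<Rightarrow>\<^sub>L 'b::real_inner)
     \<Rightarrow> ('a \<Rightarrow> real) \<Rightarrow> 'x \<times> 'y \<Rightarrow> 'a \<times> 'b" where
  "coarse_shift E K P D EH u =
     restriction P D (grad (Ebar E) u + Xi_op K u) - grad (Ebar EH) (restriction P D u)"

definition coarse_solves ::
  "('a::real_inner \<Rightarrow> ereal) \<Rightarrow> ('a \<Rightarrow> real) \<Rightarrow> ('b::real_inner \<Rightarrow> ereal)
     \<Rightarrow> 'a \<times> 'b \<Rightarrow> 'a \<times> 'b \<Rightarrow> bool" where
  "coarse_solves FH EH GH s v \<longleftrightarrow>
     0 \<in> (\<lambda>g. g + grad (Ebar EH) v + s) ` subdiff (Gbar FH GH) v"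

definition coarse_iterates ::
  "('a::real_inner \<Rightarrow> ereal) \<Rightarrow> ('a \<Rightarrow> real) \<Rightarrow> ('b::real_inner \<Rightarrow> ereal) \<Rightarrow> ('a \<Rightarrow>\<^sub>L 'b)
     \<Rightarrow> real \<Rightarrow> real \<Rightarrow> real \<Rightarrow> nat \<Rightarrow> 'a \<times> 'b \<Rightarrow> (nat \<Rightarrow> 'a \<times> 'b) \<Rightarrow> bool" where
  "coarse_iterates FH EH GH KH \<tau>H \<sigma>H vtheta m s v \<longleftrightarrow>
     (\<forall>j<m. 0 \<in> (\<lambda>g. g + Xi_op KH (v (Suc j) - ((1 - vtheta) *\<^sub>R v j + vtheta *\<^sub>R v 0))
                        + grad (Ebar EH) (v j) + s + M_op \<tau>H \<sigma>H KH (v (Suc j) - v j))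
                 ` subdiff (Gbar FH GH) (v (Suc j)))"

definition coarse_output :: "real \<Rightarrow> nat \<Rightarrow> (nat \<Rightarrow> 'c::real_vector) \<Rightarrow> 'c" where
  "coarse_output vtheta m v = (if vtheta = 1 then (1 / real m) *\<^sub>R (\<Sum>j<m. v (Suc j)) else v m)"

text \<open>
  The two alternative sufficient decrease conditions for the step length \<open>\<theta>\<close> along \<open>d\<close> from the
  point \<open>w\<close> produced by the primal-dual step.
\<close>

definition line_search_Phi where
  "line_search_Phi F E G K \<tau> \<sigma> \<kappa> \<epsilon> \<rho> w d \<theta> \<longleftrightarrow>
     Phi F E G K (w + \<theta> *\<^sub>R d) w
       + ereal (1 / 2 * (op_norm (M_op \<tau> \<sigma> K) (\<theta> *\<^sub>R d))\<^sup>2)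
       + ereal (1 / (2 * \<epsilon>) * (op_norm (W_op \<tau> \<sigma> K) (\<theta> *\<^sub>R d))\<^sup>2)
     \<le> Phi F E G K w w + ereal (\<kappa> * \<theta>) * dirderiv (\<lambda>u. Phi F E G K u w) w d + ereal (\<rho> / 2)"

definition line_search_Psi where
  "line_search_Psi F E G K \<tau> \<sigma> L \<kappa> \<epsilon> \<rho> w d \<theta> \<longleftrightarrow>
     Psi F E G K (w + \<theta> *\<^sub>R d) w
       + ereal (1 / 2 * (op_norm (\<lambda>u. M_op \<tau> \<sigma> K u + Lambda_op L u) (\<theta> *\<^sub>R d))\<^sup>2)
       + ereal (1 / (2 * \<epsilon>) * (op_norm (W_op \<tau> \<sigma> K) (\<theta> *\<^sub>R d))\<^sup>2)
     \<le> Psi F E G K w w + ereal (\<kappa> * \<theta>) * dirderiv (\<lambda>u. Psi F E G K u w) w d + ereal (\<rho> / 2)"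

text \<open>
  Runs of the primal-dual method with coarse corrections. The trigger condition is arbitrary, so
  a run is taken relative to the (arbitrary) set \<open>I\<close> of iterations at which it holds; \<open>u 0\<close> is the
  free initial point. Inner iterates, directions and step lengths are explicit sequences because
  the line search does not determine the step lengths. They are unconstrained where the
  algorithm does not compute them.
\<close>

definition pdmcc_run ::
  "('x::real_inner \<Rightarrow> ereal) \<Rightarrow> ('x \<Rightarrow> real) \<Rightarrow> ('y::real_inner \<Rightarrow> ereal) \<Rightarrow> ('x \<Rightarrow>\<^sub>L 'y)
     \<Rightarrow> real \<Rightarrow> real \<Rightarrow> real
     \<Rightarrow> ('x \<Rightarrow>\<^sub>L 'a::real_inner) \<Rightarrow> ('y \<Rightarrow>\<^sub>L 'b::real_inner)
     \<Rightarrow> (nat \<Rightarrow> 'a \<Rightarrow> ereal) \<Rightarrow> ('a \<Rightarrow> real) \<Rightarrow> (nat \<Rightarrow> 'b \<Rightarrow> ereal) \<Rightarrow> ('a \<Rightarrow>\<^sub>L 'b)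
     \<Rightarrow> real \<Rightarrow> real
     \<Rightarrow> real \<Rightarrow> nat \<Rightarrow> real \<Rightarrow> nat set \<Rightarrow> (nat \<Rightarrow> real) \<Rightarrow> (nat \<Rightarrow> real)
     \<Rightarrow> (nat \<Rightarrow> 'x \<times> 'y) \<Rightarrow> (nat \<Rightarrow> nat \<Rightarrow> 'a \<times> 'b) \<Rightarrow> (nat \<Rightarrow> 'x \<times> 'y) \<Rightarrow> (nat \<Rightarrow> real) \<Rightarrow> bool" where
  "pdmcc_run F E G K \<tau> \<sigma> L P D FH EH GH KH \<tau>H \<sigma>H \<kappa> m vtheta I \<epsilon> \<rho> u v d \<theta> \<longleftrightarrow>
     (\<forall>k. let w = pd_step F E G K \<tau> \<sigma> (u k); s = coarse_shift E K P D EH w in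
        (k \<notin> I \<longrightarrow> u (Suc k) = w) \<and>
        (k \<in> I \<longrightarrow>
           v k 0 = restriction P D w \<and>
           (if coarse_solves (FH k) EH (GH k) s (v k 0) then
              d k = 0 \<and> \<theta> k = 0
            else
              coarse_iterates (FH k) EH (GH k) KH \<tau>H \<sigma>H vtheta m s (v k) \<and>
              d k = prolongation P D (coarse_output vtheta m (v k) - v k 0) \<and>
              \<theta> k \<ge> 0 \<and>
              (line_search_Phi F E G K \<tau> \<sigma> \<kappa> (\<epsilon> k) (\<rho> k) w (d k) (\<theta> k) \<or>
               line_search_Psi F E G K \<tau> \<sigma> L \<kappa> (\<epsilon> k) (\<rho> k) w (d k) (\<theta> k))) \<and>
           u (Suc k) = w + \<theta> k *\<^sub>R d k))"

definition parameter_assumption :: "nat set \<Rightarrow> (nat \<Rightarrow> real) \<Rightarrow> (nat \<Rightarrow> real) \<Rightarrow> bool" where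
  "parameter_assumption I \<epsilon> \<rho> \<longleftrightarrow>
     (\<forall>k\<in>I. \<epsilon> k > 0 \<and> \<rho> k > 0) \<and> \<epsilon> summable_on I \<and> \<rho> summable_on I \<and>
     convergent_prod (\<lambda>k. if k \<in> I then 1 + \<epsilon> k else 1)"

definition kappa_eps :: "nat set \<Rightarrow> (nat \<Rightarrow> real) \<Rightarrow> real" where
  "kappa_eps I \<epsilon> = prodinf (\<lambda>k. if k \<in> I then 1 + \<epsilon> k else 1)"

definition ergodic :: "(nat \<Rightarrow> 'c::real_vector) \<Rightarrow> nat \<Rightarrow> 'c" where
  "ergodic u N = (1 / real N) *\<^sub>R (\<Sum>k<N. u (Suc k))"

text \<open>
  A proper convex lower semicontinuous function always satisfies
  \<open>dirderiv f u d \<ge> (SUP g\<in>subdiff f u. ereal (inner g d))\<close> where it is finite, but the inequality can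
  be strict at boundary points of the domain: for \<open>d\<close> tangent to a disk, the directional derivative
  of its indicator function is \<open>\<infinity>\<close> at the boundary, whereas the supremum is \<open>0\<close>.
\<close>

definition max_formula :: "('a::real_inner \<Rightarrow> ereal) \<Rightarrow> 'a \<Rightarrow> 'a \<Rightarrow> bool" where
  "max_formula f u d \<longleftrightarrow> dirderiv f u d = (SUP g\<in>subdiff f u. ereal (inner g d))"

end

theory Submission
  imports Defs
begin

text \<open>
  The primal-dual step is a forward-backward step preconditioned by \<open>M\<close>: its result \<open>w\<close> satisfies
  \<open>0 \<in> \<partial>Gbar(w) + \<nabla>Ebar(u) + \<Xi> w + M (w - u)\<close>. Testing this inclusion with \<open>w - z\<close> and using the
  skew-symmetry of \<open>\<Xi>\<close>, the descent lemma for \<open>E\<close> and \<open>M \<ge> \<Lambda>\<close> gives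
  \<open>gap(w) + \<parallel>w - z\<parallel>\<^sub>M\<^sup>2 / 2 \<le> \<parallel>u - z\<parallel>\<^sub>M\<^sup>2 / 2\<close> (\<open>forward_backward_estimate\<close>). The coarse iterations are steps
  of the same kind for the coarse problem, so the same estimate, compared with the initial point or
  with the previous iterate, shows that they do not increase the coarse objective.

  Coherence transfers this decrease to the fine level: every fine subgradient of the objective at
  \<open>w\<close> is mapped to a coarse one at \<open>v 0\<close>, so its product with the prolongated correction is
  nonpositive, and by the max formula the directional derivative along the correction is nonpositive
  (\<open>coarse_correction_descent\<close>, \<open>dirderiv_Phi_Psi_le_0\<close>). The line search then bounds the change
  of the objective by \<open>\<rho> / 2\<close> minus quadratic terms. The gap relative to a solution \<open>z\<close> and the squared
  distance to \<open>z\<close> together change by this amount plus the cross term \<open>\<langle>(M - \<Xi>) (w - z), \<theta> d\<rangle>\<close>. Here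
  \<open>M - \<Xi> = Z\<close>, and \<open>W = Z Z\<^sup>* / C\<close> with \<open>C \<parallel>x\<parallel>\<^sup>2 \<le> \<parallel>x\<parallel>\<^sub>M\<^sup>2\<close> is made so that Young's inequality bounds it by
  \<open>\<epsilon> \<parallel>w - z\<parallel>\<^sub>M\<^sup>2 / 2\<close> plus the \<open>W\<close>-term of the line search (\<open>Z_young\<close>, \<open>correction_estimate\<close>).

  As the gap at \<open>w\<close> is nonnegative, \<open>w\<close> is no farther from \<open>z\<close> than \<open>u\<close>, and with \<open>a k = \<parallel>u k - z\<parallel>\<^sub>M\<^sup>2\<close> one
  obtains \<open>a (k + 1) + 2 gap(u (k + 1)) \<le> (1 + \<epsilon> k) a k + \<rho> k\<close>. A discrete Gronwall argument and
  summation bound the sum of the gaps (\<open>sum_le_of_perturbed_recursion\<close>), and convexity passes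
  the bound to the ergodic average.

  The Hilbert space foundations all rest on one existence result, that of proximal points
  (\<open>prox_minimizer_exists\<close>). It gives the meaning of the algorithm, it proves Riesz representation
  (hence adjoints and gradients exist), and it yields a subgradient of \<open>G\<close>, so that the
  conjugate of \<open>G\<close> is proper.
\<close>

section \<open>Proximal points in Hilbert spaces\<close>

text \<open>Neighbourhoods need not be punctured, because \<open>f x\<close> itself exceeds every \<open>a < f x\<close>.\<close>

lemma lsc_iff_eventually:
  "lsc f \<longleftrightarrow> (\<forall>x. \<forall>a<f x. eventually (\<lambda>z. a < f z) (nhds x))"
proof -
  have "eventually (\<lambda>z. a < f z) (at x) \<longleftrightarrow> eventually (\<lambda>z. a < f z) (nhds x)" if "a < f x" for x a
  proof -
    have "(z \<noteq> x \<longrightarrow> a < f z) \<longleftrightarrow> a < f z" for z using that by auto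
    then show ?thesis by (simp only: eventually_at_filter) simp
  qed
  then show ?thesis
    unfolding lsc_def le_Liminf_iff by blast
qed

lemma econvexD:
  assumes "econvex f" "0 < t" "t < 1"
  shows "f ((1 - t) *\<^sub>R x + t *\<^sub>R y) \<le> ereal (1 - t) * f x + ereal t * f y"
  using assms unfolding econvex_def by auto

lemma subdiffD: "g \<in> subdiff f x \<Longrightarrow> f x + ereal (inner g (z - x)) \<le> f z"
  unfolding subdiff_def by blast

lemma subdiff_finite: "g \<in> subdiff f x \<Longrightarrow> \<bar>f x\<bar> \<noteq> \<infinity>"
  by (simp add: subdiff_def)

lemma properE:
  assumes "proper f"
  obtains x c where "f x = ereal c" "\<And>z. f z \<noteq> -\<infinity>"
proof -
  from assms obtain x where "f x \<noteq> \<infinity>" "\<And>z. f z \<noteq> -\<infinity>"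
    by (auto simp: proper_def)
  with that[of x "real_of_ereal (f x)"] show ?thesis
    by (metis ereal_real' ereal_infinity_cases)
qed

text \<open>
  Lower semicontinuity bounds \<open>f\<close> from below near a point of its domain, and convexity spreads
  this bound along rays with linear growth. This replaces the affine minorant that the
  Hahn--Banach theorem would give.
\<close>

lemma convex_lsc_linear_lower_bound:
  fixes f :: "'a::real_normed_vector \<Rightarrow> ereal"
  assumes cvx: "econvex f" and lsc: "lsc f" and fin: "f x0 = ereal c" and nm: "\<And>z. f z \<noteq> -\<infinity>"
  obtains s where "0 < s" "\<And>z. ereal (c - 1 - norm (z - x0) / s) \<le> f z"
proof -
  have "eventually (\<lambda>z. ereal (c - 1) < f z) (nhds x0)"
    using lsc fin unfolding lsc_iff_eventually by (metis diff_strict_left_mono diff_0_right less_ereal.simps(1) zero_less_one)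
  then obtain r where r: "r > 0" "\<And>z. dist z x0 < r \<Longrightarrow> ereal (c - 1) < f z"
    by (auto simp: eventually_nhds_metric)
  define s where "s = r / 2"
  have s: "0 < s" "s < r" using r by (auto simp: s_def)
  have "ereal (c - 1 - norm (z - x0) / s) \<le> f z" for z
  proof (cases "dist z x0 < r")
    case True
    have "ereal (c - 1 - norm (z - x0) / s) \<le> ereal (c - 1)" using s by simp
    also have "\<dots> \<le> f z" using r(2)[OF True] by simp
    finally show ?thesis .
  next
    case False
    define n where "n = norm (z - x0)"
    have n: "n \<ge> r" using False by (simp add: n_def dist_norm)
    define t where "t = s / n"
    have t: "0 < t" "t < 1" using s n by (auto simp: t_def field_simps)
    have "(1 - t) *\<^sub>R x0 + t *\<^sub>R z - x0 = t *\<^sub>R (z - x0)"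
      by (simp add: algebra_simps)
    then have "dist ((1 - t) *\<^sub>R x0 + t *\<^sub>R z) x0 = t * n"
      using t by (simp add: dist_norm n_def)
    also have "\<dots> = s" using n s by (simp add: t_def)
    finally have "ereal (c - 1) < f ((1 - t) *\<^sub>R x0 + t *\<^sub>R z)"
      using r(2) s by simp
    also have "\<dots> \<le> ereal (1 - t) * f x0 + ereal t * f z"
      by (rule econvexD[OF cvx t])
    finally have lt: "ereal (c - 1) < ereal (1 - t) * ereal c + ereal t * f z"
      by (simp add: fin)
    show ?thesis
    proof (cases "f z")
      case (real b)
      with lt have "c - 1 < (1 - t) * c + t * b" by simp
      then have "t * (c - b) < 1" by (simp add: algebra_simps)
      then have "s * (c - b) < n" using s n by (simp add: t_def field_simps)
      then have "c - b < n / s" using s by (simp add: field_simps)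
      then show ?thesis using real by (simp add: n_def)
    qed (use nm in auto)
  qed
  then show ?thesis using s(1) by (intro that)
qed

text \<open>
  The quadratic term turns a minimizing sequence into a Cauchy sequence by the parallelogram law;
  completeness gives its limit, and lower semicontinuity shows that the limit is a minimizer.
\<close>

lemma prox_minimizer_exists:
  fixes f :: "'a::{real_inner,complete_space} \<Rightarrow> ereal"
  assumes f: "proper_convex_lsc f"
  shows "\<exists>p. \<forall>z. f p + ereal ((norm (p - x))\<^sup>2 / 2) \<le> f z + ereal ((norm (z - x))\<^sup>2 / 2)"
proof -
  have cvx: "econvex f" and lsc: "lsc f" using f by (auto simp: proper_convex_lsc_def)
  obtain x0 c where fin: "f x0 = ereal c" and nm: "\<And>z. f z \<noteq> -\<infinity>"
    by (rule properE) (use f in \<open>auto simp: proper_convex_lsc_def\<close>)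
  obtain s where s: "0 < s" and lb: "\<And>z. ereal (c - 1 - norm (z - x0) / s) \<le> f z"
    by (rule convex_lsc_linear_lower_bound[OF cvx lsc fin nm]) blast
  define \<phi> where "\<phi> z = f z + ereal ((norm (z - x))\<^sup>2 / 2)" for z
  define B where "B = c - 1 - norm (x - x0) / s - (1 / s)\<^sup>2 / 2"
  \<comment> \<open>The quadratic term outgrows the linear lower bound, by Young's inequality.\<close>
  have \<phi>B: "ereal B \<le> \<phi> z" for z
  proof -
    have "norm (z - x0) / s \<le> (norm (z - x) + norm (x - x0)) / s"
      using s norm_triangle_ineq[of "z - x" "x - x0"] by (simp add: field_simps)
    moreover have "norm (z - x) * (1 / s) \<le> (norm (z - x))\<^sup>2 / 2 + (1 / s)\<^sup>2 / 2"
      using sum_squares_bound[of "norm (z - x)" "1 / s"] by simp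
    ultimately have "B \<le> c - 1 - norm (z - x0) / s + (norm (z - x))\<^sup>2 / 2"
      unfolding B_def by (simp add: add_divide_distrib)
    then have "ereal B \<le> ereal (c - 1 - norm (z - x0) / s) + ereal ((norm (z - x))\<^sup>2 / 2)" by simp
    also have "\<dots> \<le> \<phi> z" unfolding \<phi>_def by (intro add_right_mono lb)
    finally show ?thesis .
  qed
  have "ereal B \<le> (INF z. \<phi> z)" by (rule INF_greatest) (rule \<phi>B)
  moreover have "(INF z. \<phi> z) \<le> \<phi> x0" by (rule INF_lower) simp
  moreover have "\<phi> x0 < \<infinity>" by (simp add: \<phi>_def fin)
  ultimately obtain \<mu> where \<mu>: "(INF z. \<phi> z) = ereal \<mu>"
    by (cases "INF z. \<phi> z") auto
  have \<mu>_le: "ereal \<mu> \<le> \<phi> z" for z by (metis INF_lower UNIV_I \<mu>)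
  define \<eta> where "\<eta> n = 1 / real (Suc n)" for n
  have \<eta>: "\<eta> n > 0" for n by (simp add: \<eta>_def)
  have "\<exists>z. \<phi> z < ereal (\<mu> + \<eta> n)" for n
    using \<mu> \<eta>[of n] by (metis INF_less_iff UNIV_I less_add_same_cancel1 less_ereal.simps(1))
  then obtain q where q: "\<And>n. \<phi> (q n) < ereal (\<mu> + \<eta> n)" by metis
  have "\<exists>b. f (q n) = ereal b" for n
    using q[of n] nm[of "q n"] by (cases "f (q n)") (auto simp: \<phi>_def)
  then obtain b where b: "\<And>n. f (q n) = ereal (b n)" by metis
  have qb: "b n + (norm (q n - x))\<^sup>2 / 2 < \<mu> + \<eta> n" for n
    using q[of n] by (simp add: \<phi>_def b)
  \<comment> \<open>The midpoint cannot beat \<open>\<mu>\<close>, which forces the two nearly optimal points together.\<close>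
  have near: "(norm (q i - q j))\<^sup>2 \<le> 4 * (\<eta> i + \<eta> j)" for i j
  proof -
    let ?m = "(1 - 1/2) *\<^sub>R q i + (1/2::real) *\<^sub>R q j"
    have "f ?m \<le> ereal (1 - 1/2) * f (q i) + ereal (1/2) * f (q j)"
      by (rule econvexD[OF cvx]) auto
    also have "\<dots> = ereal ((b i + b j) / 2)" by (simp add: b add_divide_distrib)
    finally have fm: "f ?m \<le> ereal ((b i + b j) / 2)" .
    have "ereal \<mu> \<le> f ?m + ereal ((norm (?m - x))\<^sup>2 / 2)" using \<mu>_le[of ?m] by (simp add: \<phi>_def)
    also have "\<dots> \<le> ereal ((b i + b j) / 2) + ereal ((norm (?m - x))\<^sup>2 / 2)"
      by (intro add_right_mono fm)
    finally have "\<mu> \<le> (b i + b j) / 2 + (norm (?m - x))\<^sup>2 / 2" by simp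
    moreover have "(norm (?m - x))\<^sup>2 = (norm (q i - x))\<^sup>2 / 2 + (norm (q j - x))\<^sup>2 / 2 - (norm (q i - q j))\<^sup>2 / 4"
      by (simp add: power2_norm_eq_inner inner_simps inner_commute algebra_simps) (simp add: field_simps inner_commute)
    ultimately show ?thesis using qb[of i] qb[of j] by argo
  qed
  have "Cauchy q"
  proof (rule metric_CauchyI)
    fix e :: real assume e: "e > 0"
    obtain N where N: "8 / e\<^sup>2 < real (Suc N)"
      using reals_Archimedean2[of "8 / e\<^sup>2"] by (metis less_trans of_nat_less_iff lessI)
    have "dist (q i) (q j) < e" if "i \<ge> N" "j \<ge> N" for i j
    proof -
      have "\<eta> i \<le> 1 / real (Suc N)" "\<eta> j \<le> 1 / real (Suc N)"
        using that unfolding \<eta>_def by (auto intro!: divide_left_mono)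
      then have "4 * (\<eta> i + \<eta> j) \<le> 4 * (1 / real (Suc N) + 1 / real (Suc N))"
        by (intro mult_left_mono add_mono) auto
      then have "(norm (q i - q j))\<^sup>2 \<le> 8 * (1 / real (Suc N))" using near[of i j]
        by (simp del: of_nat_Suc)
      also have "\<dots> < e\<^sup>2" using N e by (simp add: field_simps del: of_nat_Suc)
      finally show ?thesis using e by (simp add: dist_norm power2_less_imp_less)
    qed
    then show "\<exists>M. \<forall>m\<ge>M. \<forall>n\<ge>M. dist (q m) (q n) < e" by blast
  qed
  then obtain p where p: "q \<longlonglongrightarrow> p" using Cauchy_convergent convergent_def by blast
  have \<eta>0: "\<eta> \<longlonglongrightarrow> 0" unfolding \<eta>_def by (rule LIMSEQ_inverse_real_of_nat[unfolded inverse_eq_divide])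
  have bound: "a \<le> \<mu> - (norm (p - x))\<^sup>2 / 2" if a: "ereal a < f p" for a
  proof -
    have "eventually (\<lambda>z. ereal a < f z) (nhds p)" using lsc a by (simp add: lsc_iff_eventually)
    then have "eventually (\<lambda>n. ereal a < f (q n)) sequentially"
      using p by (rule eventually_compose_filterlim)
    then have "eventually (\<lambda>n. a \<le> \<mu> + \<eta> n - (norm (q n - x))\<^sup>2 / 2) sequentially"
    proof eventually_elim
      case (elim n)
      then show ?case using qb[of n] by (simp add: b)
    qed
    moreover have "(\<lambda>n. \<mu> + \<eta> n - (norm (q n - x))\<^sup>2 / 2) \<longlonglongrightarrow> \<mu> + 0 - (norm (p - x))\<^sup>2 / 2"
      by (intro tendsto_intros p \<eta>0) auto
    ultimately have "a \<le> \<mu> + 0 - (norm (p - x))\<^sup>2 / 2"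
      by (intro tendsto_lowerbound) auto
    then show ?thesis by simp
  qed
  have "f p \<le> ereal (\<mu> - (norm (p - x))\<^sup>2 / 2)"
  proof (rule ccontr)
    assume "\<not> ?thesis"
    then have "ereal (\<mu> - (norm (p - x))\<^sup>2 / 2) < f p" by simp
    from ereal_dense2[OF this] obtain a
      where "ereal (\<mu> - (norm (p - x))\<^sup>2 / 2) < ereal a" "ereal a < f p" by auto
    with bound[of a] show False by simp
  qed
  then have "\<phi> p \<le> ereal (\<mu> - (norm (p - x))\<^sup>2 / 2) + ereal ((norm (p - x))\<^sup>2 / 2)"
    unfolding \<phi>_def by (intro add_right_mono)
  then have "\<phi> p \<le> ereal \<mu>" by simp
  then have "\<phi> p \<le> \<phi> z" for z using \<mu>_le[of z] by (rule order_trans)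
  then show ?thesis unfolding \<phi>_def by (intro exI[of _ p] allI)
qed

lemma norm_add_scaled_sq:
  fixes a b :: "'a::real_inner"
  shows "(norm (a + t *\<^sub>R b))\<^sup>2 = (norm a)\<^sup>2 + 2 * t * inner a b + t * t * (norm b)\<^sup>2"
proof -
  have "inner (a + t *\<^sub>R b) (a + t *\<^sub>R b) = inner a a + t * inner a b + t * inner b a + t * (t * inner b b)"
    by (simp add: inner_add_left inner_add_right distrib_left)
  then show ?thesis
    unfolding power2_norm_eq_inner by (simp add: inner_commute[of b a])
qed

text \<open>
  Compare the minimizer \<open>p\<close> with \<open>p + t (z - p)\<close> and let \<open>t\<close> tend to zero.
\<close>

lemma prox_subdiff:
  fixes f :: "'a::{real_inner,complete_space} \<Rightarrow> ereal"
  assumes f: "proper_convex_lsc f"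
  shows "x - prox f x \<in> subdiff f (prox f x)"
proof -
  define p where "p = prox f x"
  have cvx: "econvex f" using f by (auto simp: proper_convex_lsc_def)
  obtain x0 c where fin: "f x0 = ereal c" and nm: "\<And>z. f z \<noteq> -\<infinity>"
    by (rule properE) (use f in \<open>auto simp: proper_convex_lsc_def\<close>)
  let ?\<phi> = "\<lambda>z. f z + ereal ((norm (z - x))\<^sup>2 / 2)"
  obtain p0 where "\<And>z. ?\<phi> p0 \<le> ?\<phi> z"
    using prox_minimizer_exists[OF f] by blast
  then have "is_arg_min ?\<phi> (\<lambda>_. True) p0" by (auto simp: is_arg_min_def not_less)
  then have "is_arg_min ?\<phi> (\<lambda>_. True) p"
    unfolding p_def prox_def arg_min_def by (rule someI)
  then have min: "?\<phi> p \<le> ?\<phi> z" for z by (auto simp: is_arg_min_def not_less)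
  have "f p \<noteq> \<infinity>" using min[of x0] by (auto simp: fin)
  then obtain a where a: "f p = ereal a" using nm[of p] by (cases "f p") auto
  have "f p + ereal (inner (x - p) (z - p)) \<le> f z" for z
  proof (cases "f z")
    case (real b)
    have "a - b \<le> inner (p - x) (z - p) + t * (norm (z - p))\<^sup>2 / 2" if t: "0 < t" "t < 1" for t
    proof -
      let ?q = "(1 - t) *\<^sub>R p + t *\<^sub>R z"
      have "?\<phi> p \<le> ?\<phi> ?q" by (rule min)
      also have "\<dots> \<le> (ereal (1 - t) * f p + ereal t * f z) + ereal ((norm (?q - x))\<^sup>2 / 2)"
        by (intro add_right_mono econvexD[OF cvx t])
      finally have "a + (norm (p - x))\<^sup>2 / 2 \<le> (1 - t) * a + t * b + (norm (?q - x))\<^sup>2 / 2"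
        by (simp add: a real)
      moreover have "?q - x = (p - x) + t *\<^sub>R (z - p)" by (simp add: algebra_simps)
      then have "(norm (?q - x))\<^sup>2 = (norm (p - x))\<^sup>2 + 2 * t * inner (p - x) (z - p) + t * t * (norm (z - p))\<^sup>2"
        by (simp only: norm_add_scaled_sq)
      ultimately have "t * (a - b) \<le> t * (inner (p - x) (z - p) + t * (norm (z - p))\<^sup>2 / 2)"
        by (simp add: field_simps)
      then show ?thesis using t by (simp add: mult_le_cancel_left)
    qed
    then have "eventually (\<lambda>t. a - b \<le> inner (p - x) (z - p) + t * (norm (z - p))\<^sup>2 / 2) (at_right 0)"
      by (auto simp: eventually_at_right_field intro!: exI[of _ 1])
    moreover have "((\<lambda>t. inner (p - x) (z - p) + t * (norm (z - p))\<^sup>2 / 2) \<longlongrightarrow> inner (p - x) (z - p) + 0 * (norm (z - p))\<^sup>2 / 2) (at_right 0)"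
      by (intro tendsto_intros) auto
    ultimately have "a - b \<le> inner (p - x) (z - p) + 0 * (norm (z - p))\<^sup>2 / 2"
      by (intro tendsto_lowerbound) auto
    then have "a + inner (x - p) (z - p) \<le> b"
      by (simp add: inner_diff_left)
    then show ?thesis by (simp add: a real)
  qed (use nm in auto)
  then show ?thesis by (simp add: subdiff_def p_def[symmetric] a)
qed

lemma proper_convex_lsc_scale:
  assumes f: "proper_convex_lsc f" and c: "c > 0"
  shows "proper_convex_lsc (\<lambda>z. ereal c * f z)"
proof -
  from f have f': "proper f" "econvex f" "lsc f" by (auto simp: proper_convex_lsc_def)
  have "proper (\<lambda>z. ereal c * f z)"
    using f'(1) c by (auto simp: proper_def ereal_mult_eq_MInfty)
  moreover have "econvex (\<lambda>z. ereal c * f z)"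
    unfolding econvex_def
  proof (intro allI ballI)
    fix x y and t :: real assume "t \<in> {0<..<1}"
    then have t: "0 < t" "t < 1" by auto
    have "ereal c * f ((1 - t) *\<^sub>R x + t *\<^sub>R y) \<le> ereal c * (ereal (1 - t) * f x + ereal t * f y)"
      using c by (intro ereal_mult_left_mono econvexD[OF f'(2) t]) auto
    also have "\<dots> = ereal c * (ereal (1 - t) * f x) + ereal c * (ereal t * f y)"
      using f'(1) t c by (cases "f x"; cases "f y") (auto simp: proper_def distrib_left)
    finally show "ereal c * f ((1 - t) *\<^sub>R x + t *\<^sub>R y) \<le> ereal (1 - t) * (ereal c * f x) + ereal t * (ereal c * f y)"
      by (simp add: mult.left_commute)
  qed
  moreover have "lsc (\<lambda>z. ereal c * f z)"
    unfolding lsc_def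
  proof
    fix x
    have "ereal c * f x \<le> ereal c * Liminf (at x) f"
      using f'(3) c by (intro ereal_mult_left_mono) (auto simp: lsc_def)
    then show "ereal c * f x \<le> Liminf (at x) (\<lambda>z. ereal c * f z)"
      using c by (cases "at x = bot") (auto simp: Liminf_ereal_mult_left)
  qed
  ultimately show ?thesis by (simp add: proper_convex_lsc_def)
qed

lemma prox_scaled_subdiff:
  fixes f :: "'a::{real_inner,complete_space} \<Rightarrow> ereal" and x :: 'a
  assumes f: "proper_convex_lsc f" and c: "c > 0"
  defines "p \<equiv> prox (\<lambda>z. ereal c * f z) x"
  shows "(1 / c) *\<^sub>R (x - p) \<in> subdiff f p"
proof -
  have mem: "x - p \<in> subdiff (\<lambda>z. ereal c * f z) p"
    unfolding p_def by (rule prox_subdiff[OF proper_convex_lsc_scale[OF f c]])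
  have nm: "f z \<noteq> -\<infinity>" for z using f by (auto simp: proper_convex_lsc_def proper_def)
  obtain a where a: "f p = ereal a"
    using mem c by (cases "f p") (auto simp: subdiff_def)
  have "f p + ereal (inner ((1 / c) *\<^sub>R (x - p)) (z - p)) \<le> f z" for z
  proof (cases "f z")
    case (real b)
    have "ereal c * f p + ereal (inner (x - p) (z - p)) \<le> ereal c * f z"
      using mem by (simp add: subdiff_def)
    then have "c * a + inner (x - p) (z - p) \<le> c * b" by (simp add: a real)
    then have "a + inner (x - p) (z - p) / c \<le> b" using c by (simp add: field_simps)
    then show ?thesis by (simp add: a real)
  qed (use nm in auto)
  then show ?thesis by (simp add: subdiff_def a)
qed

section \<open>Riesz representation, adjoints and gradients\<close>

text \<open>
  The proximal point \<open>p\<close> of \<open>-f\<close> at the origin satisfies \<open>-p \<in> \<partial>(-f)(p)\<close>. A linear function that is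
  bounded below by a linear function equals it, so \<open>p\<close> represents \<open>f\<close>.
\<close>

lemma riesz_representation:
  fixes f :: "'a::{real_inner,complete_space} \<Rightarrow> real"
  assumes "bounded_linear f"
  shows "\<exists>p. \<forall>z. f z = inner p z"
proof -
  interpret f: bounded_linear f by fact
  let ?g = "\<lambda>z. ereal (- f z)"
  have "lsc ?g"
    unfolding lsc_iff_eventually
  proof (intro allI impI)
    fix x a assume "a < ?g x"
    moreover have "(?g \<longlongrightarrow> ?g x) (nhds x)"
      using f.isCont by (auto intro!: tendsto_intros f.tendsto simp: filterlim_ident)
    ultimately show "eventually (\<lambda>z. a < ?g z) (nhds x)" by (rule order_tendstoD(1)[rotated])
  qed
  then have "proper_convex_lsc ?g"
    by (auto simp: proper_convex_lsc_def proper_def econvex_def f.add f.scaleR)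
  define p where "p = prox ?g 0"
  have "0 - p \<in> subdiff ?g p"
    unfolding p_def by (rule prox_subdiff) fact
  then have "?g p + ereal (inner (0 - p) (z - p)) \<le> ?g z" for z
    unfolding subdiff_def by blast
  then have p: "- f p - inner p (z - p) \<le> - f z" for z
    by (simp add: add.commute)
  have le: "f h \<le> inner p h" for h
    using p[of "p + h"] by (simp add: f.add)
  have "f z = inner p z" for z using le[of z] le[of "- z"] by (simp add: f.neg)
  then show ?thesis by blast
qed

text \<open>
  \<^const>\<open>adjoint\<close> is a choice among operators with the adjoint identity; Riesz representation shows that
  there is one.
\<close>

lemma adjoint_inner:
  fixes f :: "'a::{real_inner,complete_space} \<Rightarrow> 'b::real_inner"
  assumes f: "bounded_linear f"
  shows "inner (f x) y = inner x (adjoint f y)"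
proof -
  have "bounded_linear (\<lambda>x. inner (f x) y)" for y
    using bounded_linear_compose[OF bounded_linear_inner_left f] .
  then have "\<exists>p. \<forall>x. inner (f x) y = inner p x" for y
    by (rule riesz_representation)
  then obtain g where "\<And>x y. inner (f x) y = inner (g y) x" by metis
  then have g: "\<forall>x y. inner (f x) y = inner x (g y)" by (simp add: inner_commute)
  then have "adjoint f = g" by (rule adjoint_unique)
  with g show ?thesis by simp
qed

lemma badjoint_inner:
  fixes K :: "'a::{real_inner,complete_space} \<Rightarrow>\<^sub>L 'b::real_inner"
  shows "inner (badjoint K y) x = inner y (blinfun_apply K x)"
  using adjoint_inner[OF blinfun.bounded_linear_right, of K x y] by (simp add: inner_commute)

lemma grad_eqI:
  assumes "GDERIV f x :> g"
  shows "grad f x = g"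
  unfolding grad_def
proof (rule the_equality)
  show "GDERIV f x :> g" by fact
next
  fix g' assume "GDERIV f x :> g'"
  then have "(\<lambda>h. inner h g') = (\<lambda>h. inner h g)"
    using assms has_derivative_unique unfolding gderiv_def by blast
  then have "inner (g' - g) g' = inner (g' - g) g" by metis
  then have "inner (g' - g) (g' - g) = 0" by (simp add: inner_diff_right)
  then show "g' = g" by simp
qed

lemma GDERIV_grad:
  fixes f :: "'a::{real_inner,complete_space} \<Rightarrow> real"
  assumes "f differentiable (at x)"
  shows "GDERIV f x :> grad f x"
proof -
  obtain f' where f': "(f has_derivative f') (at x)" using assms unfolding differentiable_def ..
  obtain p where "\<And>z. f' z = inner p z"
    using riesz_representation[OF has_derivative_bounded_linear[OF f']] by metis
  then have "f' = (\<lambda>h. inner h p)" by (simp add: fun_eq_iff inner_commute)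
  then have p: "GDERIV f x :> p"
    using f' by (simp add: gderiv_def)
  then show ?thesis by (simp add: grad_eqI[OF p])
qed

section \<open>Convex functions with values in the extended reals\<close>

text \<open>
  The proximal map provides a subgradient of \<open>f\<close> at some point. The conjugate is finite at this
  subgradient, and hence proper.
\<close>

lemma proper_convex_lsc_fenchel_conj:
  fixes f :: "'a::{real_inner,complete_space} \<Rightarrow> ereal"
  assumes f: "proper_convex_lsc f"
  shows "proper_convex_lsc (fenchel_conj f)"
proof -
  obtain x0 c where fin: "f x0 = ereal c" and nm: "\<And>z. f z \<noteq> -\<infinity>"
    by (rule properE) (use f in \<open>auto simp: proper_convex_lsc_def\<close>)
  have upper: "ereal (inner y x) - f x \<le> fenchel_conj f y" for x y
    unfolding fenchel_conj_def by (rule SUP_upper) simp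
  have "fenchel_conj f y \<noteq> -\<infinity>" for y
    using upper[of y x0] by (auto simp: fin)
  moreover have "\<exists>y. fenchel_conj f y \<noteq> \<infinity>"
  proof -
    define p where "p = prox f 0"
    have g: "0 - p \<in> subdiff f p" unfolding p_def by (rule prox_subdiff[OF f])
    then obtain a where a: "f p = ereal a" by (cases "f p") (auto simp: subdiff_def)
    have "fenchel_conj f (0 - p) \<le> ereal (inner (0 - p) p - a)"
      unfolding fenchel_conj_def
    proof (rule SUP_least)
      fix z
      have "f p + ereal (inner (0 - p) (z - p)) \<le> f z" using g unfolding subdiff_def by blast
      then show "ereal (inner (0 - p) z) - f z \<le> ereal (inner (0 - p) p - a)"
        using nm[of z] by (cases "f z") (auto simp: a inner_diff_right)
    qed
    then show ?thesis by (intro exI[of _ "0 - p"]) auto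
  qed
  moreover have "econvex (fenchel_conj f)"
    unfolding econvex_def
  proof (intro allI ballI)
    fix y z :: 'a and t :: real assume "t \<in> {0<..<1}"
    then have t: "0 < t" "t < 1" by auto
    show "fenchel_conj f ((1 - t) *\<^sub>R y + t *\<^sub>R z)
            \<le> ereal (1 - t) * fenchel_conj f y + ereal t * fenchel_conj f z"
      unfolding fenchel_conj_def[of f "(1 - t) *\<^sub>R y + t *\<^sub>R z"]
    proof (rule SUP_least)
      fix x
      show "ereal (inner ((1 - t) *\<^sub>R y + t *\<^sub>R z) x) - f x
              \<le> ereal (1 - t) * fenchel_conj f y + ereal t * fenchel_conj f z"
      proof (cases "f x")
        case (real r)
        have "ereal (inner ((1 - t) *\<^sub>R y + t *\<^sub>R z) x) - f x
                = ereal (1 - t) * (ereal (inner y x) - f x) + ereal t * (ereal (inner z x) - f x)"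
          by (simp add: real inner_add_left algebra_simps)
        also have "\<dots> \<le> ereal (1 - t) * fenchel_conj f y + ereal t * fenchel_conj f z"
          using t by (intro add_mono ereal_mult_left_mono upper) auto
        finally show ?thesis .
      qed (use nm in auto)
    qed
  qed
  moreover have "lsc (fenchel_conj f)"
    unfolding lsc_iff_eventually
  proof (intro allI impI)
    fix y a assume "a < fenchel_conj f y"
    then obtain x where x: "a < ereal (inner y x) - f x"
      unfolding fenchel_conj_def less_SUP_iff by blast
    then obtain r where r: "f x = ereal r" using nm[of x] by (cases "f x") auto
    have "((\<lambda>z. inner z x - r) \<longlongrightarrow> inner y x - r) (nhds y)"
      by (intro tendsto_intros filterlim_ident)
    then have "((\<lambda>z. ereal (inner z x - r)) \<longlongrightarrow> ereal (inner y x - r)) (nhds y)"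
      by simp
    then have "eventually (\<lambda>z. a < ereal (inner z x - r)) (nhds y)"
      using x by (intro order_tendstoD(1)) (auto simp: r)
    then show "eventually (\<lambda>z. a < fenchel_conj f z) (nhds y)"
    proof eventually_elim
      case (elim z)
      with upper[of z x] show ?case by (simp add: r)
    qed
  qed
  ultimately show ?thesis by (simp add: proper_convex_lsc_def proper_def)
qed

lemma econvex_add_convex:
  fixes f :: "'a::real_vector \<Rightarrow> ereal" and e :: "'a \<Rightarrow> real"
  assumes f: "econvex f" "\<And>z. f z \<noteq> -\<infinity>"
    and e: "\<And>x y t. 0 < t \<Longrightarrow> t < 1 \<Longrightarrow> e ((1 - t) *\<^sub>R x + t *\<^sub>R y) \<le> (1 - t) * e x + t * e y"
  shows "econvex (\<lambda>z. f z + ereal (e z))"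
  unfolding econvex_def
proof (intro allI ballI)
  fix x y :: 'a and t :: real assume "t \<in> {0<..<1}"
  then have t: "0 < t" "t < 1" by auto
  let ?q = "(1 - t) *\<^sub>R x + t *\<^sub>R y"
  have "f ?q + ereal (e ?q) \<le> (ereal (1 - t) * f x + ereal t * f y) + ereal ((1 - t) * e x + t * e y)"
    using econvexD[OF f(1) t] e[OF t] by (intro add_mono) auto
  also have "\<dots> = ereal (1 - t) * (f x + ereal (e x)) + ereal t * (f y + ereal (e y))"
    using t f(2)[of x] f(2)[of y] by (cases "f x"; cases "f y") (auto simp: algebra_simps)
  finally show "f ?q + ereal (e ?q) \<le> ereal (1 - t) * (f x + ereal (e x)) + ereal t * (f y + ereal (e y))" .
qed

text \<open>
  Jensen's inequality for equal weights, adding one point at a time to the running average.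
\<close>

lemma econvex_average:
  assumes f: "econvex f" and b: "\<And>k. k < N \<Longrightarrow> f (v k) \<le> ereal (b k)" and N: "N \<ge> 1"
  shows "f ((1 / real N) *\<^sub>R (\<Sum>k<N. v k)) \<le> ereal ((1 / real N) * (\<Sum>k<N. b k))"
  using N b
proof (induction N rule: nat_induct_at_least)
  case base
  then show ?case by simp
next
  case (Suc n)
  define t where "t = 1 / real (Suc n)"
  have t: "0 < t" "t < 1" using Suc.hyps by (auto simp: t_def)
  have scale: "(1 - t) * (1 / real n) = t" using Suc.hyps by (simp add: t_def field_simps)
  have avg: "(1 - t) *\<^sub>R ((1 / real n) *\<^sub>R (\<Sum>k<n. v k)) = t *\<^sub>R (\<Sum>k<n. v k)"
    unfolding scaleR_scaleR scale ..
  have "(1 / real (Suc n)) *\<^sub>R (\<Sum>k<Suc n. v k)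
      = (1 - t) *\<^sub>R ((1 / real n) *\<^sub>R (\<Sum>k<n. v k)) + t *\<^sub>R v n"
    unfolding avg by (simp add: t_def[symmetric] scaleR_add_right del: of_nat_Suc)
  then have "f ((1 / real (Suc n)) *\<^sub>R (\<Sum>k<Suc n. v k))
      \<le> ereal (1 - t) * f ((1 / real n) *\<^sub>R (\<Sum>k<n. v k)) + ereal t * f (v n)"
    using econvexD[OF f t] by metis
  also have "\<dots> \<le> ereal (1 - t) * ereal ((1 / real n) * (\<Sum>k<n. b k)) + ereal t * ereal (b n)"
    using t Suc by (intro add_mono ereal_mult_left_mono) auto
  also have "\<dots> = ereal ((1 - t) * (1 / real n) * (\<Sum>k<n. b k) + t * b n)"
    by (simp add: mult.assoc)
  also have "\<dots> = ereal ((1 / real (Suc n)) * (\<Sum>k<Suc n. b k))"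
    unfolding scale by (simp add: t_def[symmetric] distrib_left del: of_nat_Suc)
  finally show ?case .
qed

lemma GDERIV_along_line:
  assumes "GDERIV f (x + t *\<^sub>R h) :> g"
  shows "((\<lambda>t. f (x + t *\<^sub>R h)) has_field_derivative inner g h) (at t)"
proof -
  have line: "((\<lambda>t. x + t *\<^sub>R h) has_derivative (\<lambda>t. t *\<^sub>R h)) (at t)"
    by (auto intro!: derivative_eq_intros)
  have "(f has_derivative (\<lambda>h. inner h g)) (at (x + t *\<^sub>R h))"
    using assms by (simp add: gderiv_def)
  from has_derivative_compose[OF line this]
  have "((\<lambda>t. f (x + t *\<^sub>R h)) has_derivative (\<lambda>t. inner (t *\<^sub>R h) g)) (at t)" .
  moreover have "(\<lambda>t. inner (t *\<^sub>R h) g) = (*) (inner g h)"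
    by (simp add: fun_eq_iff inner_commute)
  ultimately show ?thesis
    unfolding has_field_derivative_def by simp
qed

text \<open>
  The difference quotient of a convex function is nondecreasing in the step, so it converges to
  its infimum.
\<close>

lemma dirderiv_tendsto:
  assumes f: "econvex f" "\<And>z. f z \<noteq> -\<infinity>" and fin: "f w = ereal c"
  shows "((\<lambda>t::real. (f (w + t *\<^sub>R d) - f w) / ereal t) \<longlongrightarrow> dirderiv f w d) (at_right 0)"
proof -
  define q where "q t = (f (w + t *\<^sub>R d) - f w) / ereal t" for t :: real
  have mono: "q s \<le> q t" if st: "0 < s" "s < t" for s t
  proof (cases "f (w + t *\<^sub>R d)")
    case (real b)
    define r where "r = s / t"
    have r: "0 < r" "r < 1" using st by (auto simp: r_def)
    have "(1 - r) *\<^sub>R w + r *\<^sub>R (w + t *\<^sub>R d) = w + s *\<^sub>R d"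
      using st by (simp add: algebra_simps r_def)
    then have le: "f (w + s *\<^sub>R d) \<le> ereal ((1 - r) * c + r * b)"
      using econvexD[OF f(1) r, of w "w + t *\<^sub>R d"] by (simp add: fin real)
    then obtain a where a: "f (w + s *\<^sub>R d) = ereal a"
      using f(2)[of "w + s *\<^sub>R d"] by (cases "f (w + s *\<^sub>R d)") auto
    have "a - c \<le> r * (b - c)" using le a by (simp add: algebra_simps)
    then have "(a - c) / s \<le> (b - c) / t" using st by (simp add: r_def field_simps)
    then show ?thesis using st by (simp add: q_def a real fin)
  qed (use f(2) st in \<open>auto simp: q_def fin\<close>)
  have "(q \<longlongrightarrow> (INF t\<in>{0<..}. q t)) (at_right 0)"
  proof (rule order_tendstoI)
    fix a assume a: "a < (INF t\<in>{0<..}. q t)"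
    have "a < q t" if "0 < t" for t
      using less_INF_D[OF a, of t] that by simp
    then show "eventually (\<lambda>t. a < q t) (at_right 0)"
      by (auto simp: eventually_at_right_field intro!: exI[of _ 1])
  next
    fix a assume "(INF t\<in>{0<..}. q t) < a"
    then obtain t where t: "0 < t" "q t < a" by (auto simp: INF_less_iff)
    have "q s < a" if "0 < s" "s < t" for s using mono[OF that] t by simp
    then show "eventually (\<lambda>t. q t < a) (at_right 0)"
      using t by (auto simp: eventually_at_right_field intro!: exI[of _ t])
  qed
  moreover from this have "dirderiv f w d = (INF t\<in>{0<..}. q t)"
    unfolding dirderiv_def q_def by (intro tendsto_Lim) auto
  ultimately show ?thesis unfolding q_def by simp
qed

text \<open>
  The limits add even if the first one is infinite, because the second one is finite.
\<close>

lemma dirderiv_add_GDERIV: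
  assumes f: "econvex f" "\<And>z. f z \<noteq> -\<infinity>" and fin: "f w = ereal c" and e: "GDERIV e w :> g"
  shows "dirderiv (\<lambda>z. f z + ereal (e z)) w d = dirderiv f w d + ereal (inner g d)"
proof -
  define r where "r t = (e (w + t *\<^sub>R d) - e w) / t" for t
  have "((\<lambda>t. e (w + t *\<^sub>R d)) has_field_derivative inner g d) (at 0)"
    by (rule GDERIV_along_line) (simp add: e)
  then have "(r \<longlongrightarrow> inner g d) (at 0)"
    unfolding r_def by (simp add: DERIV_def)
  then have "(r \<longlongrightarrow> inner g d) (at_right 0)"
    by (rule filterlim_mono) (auto simp: at_le)
  then have "((\<lambda>t. ereal (r t)) \<longlongrightarrow> ereal (inner g d)) (at_right 0)" by simp
  from tendsto_add_ereal_general1[OF _ dirderiv_tendsto[OF f fin, of d] this]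
  have "((\<lambda>t. (f (w + t *\<^sub>R d) - f w) / ereal t + ereal (r t))
           \<longlongrightarrow> dirderiv f w d + ereal (inner g d)) (at_right 0)" by simp
  moreover have "eventually (\<lambda>t. (f (w + t *\<^sub>R d) - f w) / ereal t + ereal (r t)
      = (f (w + t *\<^sub>R d) + ereal (e (w + t *\<^sub>R d)) - (f w + ereal (e w))) / ereal t) (at_right 0)"
    unfolding eventually_at_right_field
  proof (intro exI[of _ 1] conjI allI impI)
    fix t :: real assume t: "0 < t"
    show "(f (w + t *\<^sub>R d) - f w) / ereal t + ereal (r t)
      = (f (w + t *\<^sub>R d) + ereal (e (w + t *\<^sub>R d)) - (f w + ereal (e w))) / ereal t"
      using f(2)[of "w + t *\<^sub>R d"] t
      by (cases "f (w + t *\<^sub>R d)") (auto simp: fin r_def field_simps)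
  qed simp
  ultimately have "((\<lambda>t. (f (w + t *\<^sub>R d) + ereal (e (w + t *\<^sub>R d)) - (f w + ereal (e w))) / ereal t)
           \<longlongrightarrow> dirderiv f w d + ereal (inner g d)) (at_right 0)"
    by (rule Lim_transform_eventually)
  then show ?thesis
    unfolding dirderiv_def[of "\<lambda>z. f z + ereal (e z)"] by (intro tendsto_Lim) auto
qed

section \<open>Smooth convex functions\<close>

text \<open>Apply the one-dimensional statement along the segment from \<open>x\<close> to \<open>z\<close>.\<close>

lemma convex_gradient_inequality:
  fixes f :: "'a::real_inner \<Rightarrow> real"
  assumes f: "\<And>x y t. 0 < t \<Longrightarrow> t < 1 \<Longrightarrow> f ((1 - t) *\<^sub>R x + t *\<^sub>R y) \<le> (1 - t) * f x + t * f y"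
    and g: "GDERIV f x :> g"
  shows "f x + inner g (z - x) \<le> f z"
proof -
  let ?\<phi> = "\<lambda>t::real. f (x + t *\<^sub>R (z - x))"
  have "convex_on UNIV ?\<phi>"
  proof (rule convex_onI)
    fix t a b :: real assume t: "0 < t" "t < 1"
    have "x + ((1 - t) *\<^sub>R a + t *\<^sub>R b) *\<^sub>R (z - x)
        = (1 - t) *\<^sub>R (x + a *\<^sub>R (z - x)) + t *\<^sub>R (x + b *\<^sub>R (z - x))"
      by (simp add: algebra_simps)
    then show "?\<phi> ((1 - t) *\<^sub>R a + t *\<^sub>R b) \<le> (1 - t) * ?\<phi> a + t * ?\<phi> b"
      using f[OF t] by metis
  qed simp
  moreover have "(?\<phi> has_field_derivative inner g (z - x)) (at 0)"
    by (rule GDERIV_along_line) (simp add: g)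
  ultimately have "?\<phi> 1 - ?\<phi> 0 \<ge> inner g (z - x) * (1 - 0)"
    by (intro convex_on_imp_above_tangent[of UNIV]) auto
  then show ?thesis by simp
qed

text \<open>
  Along the segment, \<open>\<phi>\<close> is \<open>f\<close> minus the claimed upper bound, up to a constant. The Lipschitz
  condition makes its derivative nonpositive.
\<close>

lemma lipschitz_gradient_descent:
  fixes f :: "'a::real_inner \<Rightarrow> real"
  assumes g: "\<And>x. GDERIV f x :> g x" and lip: "L-lipschitz_on UNIV g"
  shows "f z \<le> f x + inner (g x) (z - x) + L / 2 * (norm (z - x))\<^sup>2"
proof -
  define h where "h = z - x"
  define \<phi> where "\<phi> t = f (x + t *\<^sub>R h) - t * inner (g x) h - L / 2 * t\<^sup>2 * (norm h)\<^sup>2" for t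
  have "\<exists>y. (\<phi> has_field_derivative y) (at t) \<and> y \<le> 0" if t: "0 \<le> t" for t
  proof (intro exI conjI)
    show "(\<phi> has_field_derivative (inner (g (x + t *\<^sub>R h)) h - inner (g x) h - L * t * (norm h)\<^sup>2)) (at t)"
      unfolding \<phi>_def
      by (rule derivative_eq_intros GDERIV_along_line g refl | simp)+
    have "inner (g (x + t *\<^sub>R h) - g x) h \<le> norm (g (x + t *\<^sub>R h) - g x) * norm h"
      by (rule norm_cauchy_schwarz)
    also have "\<dots> \<le> (L * norm (t *\<^sub>R h)) * norm h"
      using lipschitz_onD[OF lip, of "x + t *\<^sub>R h" x] by (intro mult_right_mono) (auto simp: dist_norm)
    also have "\<dots> = L * t * (norm h)\<^sup>2" using t by (simp add: power2_eq_square)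
    finally show "inner (g (x + t *\<^sub>R h)) h - inner (g x) h - L * t * (norm h)\<^sup>2 \<le> 0"
      by (simp add: inner_diff_left)
  qed
  then have "\<phi> 1 \<le> \<phi> 0"
    by (intro DERIV_nonpos_imp_nonincreasing[of 0 1 \<phi>]) auto
  then show ?thesis by (simp add: \<phi>_def h_def)
qed

section \<open>Block operators\<close>

lemma M_op_inner:
  fixes K :: "'x::{real_inner,complete_space} \<Rightarrow>\<^sub>L 'y::{real_inner,complete_space}"
  shows "inner (M_op \<tau> \<sigma> K u) w = inner (fst u) (fst w) / \<tau> - inner (snd u) (blinfun_apply K (fst w))
           - inner (snd w) (blinfun_apply K (fst u)) + inner (snd u) (snd w) / \<sigma>"
  by (simp add: M_op_def block_op_def inner_prod_def inner_diff_left badjoint_inner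
      inner_commute[of "blinfun_apply K (fst u)" "snd w"] divide_inverse mult.commute)

lemma Xi_op_inner:
  fixes K :: "'x::{real_inner,complete_space} \<Rightarrow>\<^sub>L 'y::{real_inner,complete_space}"
  shows "inner (Xi_op K u) w = inner (snd u) (blinfun_apply K (fst w)) - inner (snd w) (blinfun_apply K (fst u))"
  by (simp add: Xi_op_def block_op_def inner_prod_def badjoint_inner
      inner_commute[of "blinfun_apply K (fst u)" "snd w"])

lemma Xi_op_zero:
  fixes K :: "'x::{real_inner,complete_space} \<Rightarrow>\<^sub>L 'y::{real_inner,complete_space}"
  shows "Xi_op K 0 = 0"
proof -
  have "inner (Xi_op K 0) (Xi_op K 0) = 0" by (simp only: Xi_op_inner) simp
  then show ?thesis by simp
qed

lemma adjoint_Z_op: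
  fixes K :: "'x::{real_inner,complete_space} \<Rightarrow>\<^sub>L 'y::{real_inner,complete_space}"
  shows "adjoint (Z_op \<tau> \<sigma> K)
    = (\<lambda>u. (inverse \<tau> *\<^sub>R fst u, inverse \<sigma> *\<^sub>R snd u - 2 *\<^sub>R blinfun_apply K (fst u)))"
  by (rule adjoint_unique)
    (auto simp: Z_op_def block_op_def inner_prod_def inner_diff_left inner_diff_right badjoint_inner)

text \<open>Corrections are paired with errors through \<open>M - \<Xi> = Z\<close>, which is why \<open>W\<close> is built from \<open>Z\<close>.\<close>

lemma inner_adjoint_Z_op:
  fixes K :: "'x::{real_inner,complete_space} \<Rightarrow>\<^sub>L 'y::{real_inner,complete_space}"
  shows "inner w (adjoint (Z_op \<tau> \<sigma> K) b) = inner (M_op \<tau> \<sigma> K w) b - inner (Xi_op K w) b"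
  unfolding adjoint_Z_op M_op_inner Xi_op_inner
  by (simp add: inner_prod_def inner_diff_right divide_inverse mult.commute)

lemma inner_W_op:
  fixes K :: "'x::{real_inner,complete_space} \<Rightarrow>\<^sub>L 'y::{real_inner,complete_space}"
  shows "inner (W_op \<tau> \<sigma> K b) b = (norm (adjoint (Z_op \<tau> \<sigma> K) b))\<^sup>2 / C_const \<tau> \<sigma> K"
proof -
  have "inner (Z_op \<tau> \<sigma> K a) b = inner a (adjoint (Z_op \<tau> \<sigma> K) b)" for a
    unfolding adjoint_Z_op
    by (simp add: Z_op_def block_op_def inner_prod_def inner_diff_left inner_diff_right badjoint_inner)
  then show ?thesis by (simp add: W_op_def power2_norm_eq_inner)
qed

lemma M_op_add:
  fixes K :: "'x::{real_inner,complete_space} \<Rightarrow>\<^sub>L 'y::{real_inner,complete_space}"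
  shows "inner (M_op \<tau> \<sigma> K (a + b)) (a + b)
    = inner (M_op \<tau> \<sigma> K a) a + 2 * inner (M_op \<tau> \<sigma> K a) b + inner (M_op \<tau> \<sigma> K b) b"
  by (simp add: M_op_inner inner_add_left inner_add_right blinfun.add_right add_divide_distrib
      inner_commute[of "fst b" "fst a"] inner_commute[of "snd b" "snd a"])

lemma M_op_three_point:
  fixes K :: "'x::{real_inner,complete_space} \<Rightarrow>\<^sub>L 'y::{real_inner,complete_space}"
  shows "2 * inner (M_op \<tau> \<sigma> K (p - u)) (p - z) = inner (M_op \<tau> \<sigma> K (p - u)) (p - u)
           + inner (M_op \<tau> \<sigma> K (p - z)) (p - z) - inner (M_op \<tau> \<sigma> K (u - z)) (u - z)"
  using M_op_add[of \<tau> \<sigma> K "p - u" "u - z"] by (simp add: inner_diff_right)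

section \<open>The saddle point structure\<close>

text \<open>
  One family of objectives for both levels: \<open>\<Phi>(\<cdot>; w)\<close> is the fine objective with tilt \<open>\<Xi> w\<close>, and the
  coarse problem minimizes the coarse objective whose tilt is the first-order consistency shift.
\<close>

definition tilted_objective ::
  "('x::real_inner \<Rightarrow> ereal) \<Rightarrow> ('x \<Rightarrow> real) \<Rightarrow> ('y::real_inner \<Rightarrow> ereal) \<Rightarrow> 'x \<times> 'y \<Rightarrow> 'x \<times> 'y \<Rightarrow> ereal" where
  "tilted_objective F E G s u = Gbar F G u + ereal (Ebar E u + inner s u)"

lemma Phi_eq_tilted: "Phi F E G K u w = tilted_objective F E G (Xi_op K w) u"
  by (simp add: Phi_def tilted_objective_def add.assoc)

locale saddle_structure =
  fixes F :: "'x::{real_inner,complete_space} \<Rightarrow> ereal"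
    and E :: "'x \<Rightarrow> real"
    and G :: "'y::{real_inner,complete_space} \<Rightarrow> ereal"
    and K :: "'x \<Rightarrow>\<^sub>L 'y"
    and \<tau> \<sigma> L :: real
  assumes saddle: "structure_assumption F E G K \<tau> \<sigma> L"
begin

abbreviation "M \<equiv> M_op \<tau> \<sigma> K"
abbreviation "\<Xi> \<equiv> Xi_op K"
abbreviation "C \<equiv> C_const \<tau> \<sigma> K"
abbreviation "\<Gamma> \<equiv> Gbar F G"
abbreviation "J \<equiv> tilted_objective F E G"

lemma F_pcl: "proper_convex_lsc F" and G_pcl: "proper_convex_lsc G" and E_pcl: "proper_convex_lsc (\<lambda>x. ereal (E x))"
  and E_differentiable: "E differentiable_on UNIV" and E_lipschitz: "L-lipschitz_on UNIV (grad E)"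
  and \<tau>: "\<tau> > 0" and \<sigma>: "\<sigma> > 0" and step_lengths: "\<tau> * L + \<tau> * \<sigma> * (norm K)\<^sup>2 < 1"
  using saddle by (auto simp: structure_assumption_def)

lemma L: "0 \<le> L"
  using E_lipschitz by (rule lipschitz_on_nonneg)

lemma Gbar_not_MInf: "\<Gamma> u \<noteq> -\<infinity>"
  using F_pcl proper_convex_lsc_fenchel_conj[OF G_pcl]
  by (simp add: Gbar_def proper_convex_lsc_def proper_def)

lemma econvex_Gbar: "econvex \<Gamma>"
  unfolding econvex_def
proof (intro allI ballI)
  fix u w :: "'x \<times> 'y" and t :: real assume "t \<in> {0<..<1}"
  then have t: "0 < t" "t < 1" by auto
  have F': "econvex F" "\<And>z. F z \<noteq> -\<infinity>" and G': "econvex (fenchel_conj G)" "\<And>z. fenchel_conj G z \<noteq> -\<infinity>"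
    using F_pcl proper_convex_lsc_fenchel_conj[OF G_pcl] by (auto simp: proper_convex_lsc_def proper_def)
  have "\<Gamma> ((1 - t) *\<^sub>R u + t *\<^sub>R w)
      \<le> (ereal (1 - t) * F (fst u) + ereal t * F (fst w))
        + (ereal (1 - t) * fenchel_conj G (snd u) + ereal t * fenchel_conj G (snd w))"
    unfolding Gbar_def using econvexD[OF F'(1) t] econvexD[OF G'(1) t] by (auto intro!: add_mono)
  also have "\<dots> = ereal (1 - t) * \<Gamma> u + ereal t * \<Gamma> w"
    using t F'(2)[of "fst u"] F'(2)[of "fst w"] G'(2)[of "snd u"] G'(2)[of "snd w"]
    unfolding Gbar_def
    by (cases "F (fst u)"; cases "F (fst w)"; cases "fenchel_conj G (snd u)"; cases "fenchel_conj G (snd w)")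
      (auto simp: algebra_simps)
  finally show "\<Gamma> ((1 - t) *\<^sub>R u + t *\<^sub>R w) \<le> ereal (1 - t) * \<Gamma> u + ereal t * \<Gamma> w" .
qed

lemma E_convex: "0 < t \<Longrightarrow> t < 1 \<Longrightarrow> E ((1 - t) *\<^sub>R x + t *\<^sub>R y) \<le> (1 - t) * E x + t * E y"
  using econvexD[of "\<lambda>x. ereal (E x)" t x y] E_pcl by (simp add: proper_convex_lsc_def)

lemma GDERIV_E: "GDERIV E x :> grad E x"
  using E_differentiable by (intro GDERIV_grad) (auto simp: differentiable_on_def)

lemma GDERIV_Ebar: "GDERIV (Ebar E) u :> (grad E (fst u), 0)"
proof -
  have "(fst has_derivative fst) (at u)"
    by (rule has_derivative_fst[OF has_derivative_ident])
  from has_derivative_compose[OF this GDERIV_E[of "fst u", unfolded gderiv_def]]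
  have "((\<lambda>u. E (fst u)) has_derivative (\<lambda>h. inner (fst h) (grad E (fst u)))) (at u)" .
  then show ?thesis by (simp add: gderiv_def Ebar_def[abs_def] inner_prod_def)
qed

lemma grad_Ebar: "grad (Ebar E) u = (grad E (fst u), 0)"
  by (rule grad_eqI[OF GDERIV_Ebar])

lemma Ebar_gradient_inequality: "Ebar E u + inner (grad (Ebar E) u) (z - u) \<le> Ebar E z"
  using convex_gradient_inequality[OF E_convex GDERIV_E, of "fst u" "fst z"]
  by (simp add: Ebar_def grad_Ebar inner_prod_def)

lemma Ebar_descent:
  "Ebar E z \<le> Ebar E u + inner (grad (Ebar E) u) (z - u) + L / 2 * (norm (fst (z - u)))\<^sup>2"
  using lipschitz_gradient_descent[OF GDERIV_E E_lipschitz, of "fst z" "fst u"]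
  by (simp add: Ebar_def grad_Ebar inner_prod_def)

subsection \<open>Bounds for the preconditioner\<close>

text \<open>Complete the square in the dual variable and use the step length condition.\<close>

lemma M_ge_Lambda: "L * (norm (fst u))\<^sup>2 \<le> inner (M u) u"
proof -
  define a b k where "a = norm (fst u)" and "b = norm (snd u)" and "k = norm K"
  have "inner (snd u) (blinfun_apply K (fst u)) \<le> b * (k * a)"
    unfolding a_def b_def k_def
    by (rule order_trans[OF norm_cauchy_schwarz]) (simp add: mult_left_mono norm_blinfun)
  then have "a\<^sup>2 / \<tau> - 2 * (b * (k * a)) + b\<^sup>2 / \<sigma> \<le> inner (M u) u"
    by (simp add: M_op_inner a_def b_def power2_norm_eq_inner)
  moreover have "a\<^sup>2 / \<tau> - 2 * (b * (k * a)) + b\<^sup>2 / \<sigma>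
      = L * a\<^sup>2 + (1 - (\<tau> * L + \<tau> * \<sigma> * k\<^sup>2)) / \<tau> * a\<^sup>2 + (b - \<sigma> * k * a)\<^sup>2 / \<sigma>"
    using \<tau> \<sigma> by (simp add: field_simps power2_eq_square)
  moreover have "0 \<le> (1 - (\<tau> * L + \<tau> * \<sigma> * k\<^sup>2)) / \<tau> * a\<^sup>2" "0 \<le> (b - \<sigma> * k * a)\<^sup>2 / \<sigma>"
    using step_lengths \<tau> \<sigma> by (auto simp: k_def)
  ultimately show ?thesis unfolding a_def by linarith
qed

lemma M_nonneg: "0 \<le> inner (M u) u"
  using M_ge_Lambda[of u] L by (meson mult_nonneg_nonneg order_trans zero_le_power2)

lemma op_norm_M: "(op_norm M u)\<^sup>2 = inner (M u) u"
  by (simp add: op_norm_def M_nonneg)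

lemma sqrt_norm_K: "sqrt (\<tau> * \<sigma>) * norm K < 1"
proof -
  have "\<tau> * \<sigma> * (norm K)\<^sup>2 < 1"
    using step_lengths mult_nonneg_nonneg[OF less_imp_le[OF \<tau>] L] by linarith
  then have "(sqrt (\<tau> * \<sigma>) * norm K)\<^sup>2 < 1\<^sup>2"
    using \<tau> \<sigma> by (simp add: power_mult_distrib)
  then show ?thesis by (rule power2_less_imp_less) simp
qed

lemma C_pos: "0 < C"
  unfolding C_const_def using sqrt_norm_K \<tau> \<sigma> by simp

text \<open>Young's inequality with weights \<open>\<tau>\<close> and \<open>\<sigma>\<close> bounds the off-diagonal part of \<open>M\<close>.\<close>

lemma M_ge_C: "C * (norm u)\<^sup>2 \<le> inner (M u) u"
proof -
  define a b k q where "a = norm (fst u)" and "b = norm (snd u)" and "k = norm K" and "q = sqrt (\<tau> * \<sigma>)"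
  have q: "0 < q" "q * q = \<tau> * \<sigma>" using \<tau> \<sigma> by (auto simp: q_def)
  have "inner (snd u) (blinfun_apply K (fst u)) \<le> b * (k * a)"
    unfolding a_def b_def k_def
    by (rule order_trans[OF norm_cauchy_schwarz]) (simp add: mult_left_mono norm_blinfun)
  then have 1: "a\<^sup>2 / \<tau> - 2 * (b * (k * a)) + b\<^sup>2 / \<sigma> \<le> inner (M u) u"
    by (simp add: M_op_inner a_def b_def power2_norm_eq_inner)
  have "2 * (a / sqrt \<tau>) * (b / sqrt \<sigma>) \<le> (a / sqrt \<tau>)\<^sup>2 + (b / sqrt \<sigma>)\<^sup>2"
    by (rule sum_squares_bound)
  then have "2 * (a * b) / q \<le> a\<^sup>2 / \<tau> + b\<^sup>2 / \<sigma>"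
    using \<tau> \<sigma> by (simp add: power_divide q_def real_sqrt_mult)
  then have "2 * (a * b) \<le> q * (a\<^sup>2 / \<tau> + b\<^sup>2 / \<sigma>)"
    using q by (simp add: pos_divide_le_eq mult.commute)
  then have "k * (2 * (a * b)) \<le> k * (q * (a\<^sup>2 / \<tau> + b\<^sup>2 / \<sigma>))"
    by (intro mult_left_mono) (auto simp: k_def)
  then have 2: "2 * (b * (k * a)) \<le> q * k * (a\<^sup>2 / \<tau> + b\<^sup>2 / \<sigma>)"
    by (simp only: mult_ac)
  have "min (inverse \<tau>) (inverse \<sigma>) * a\<^sup>2 \<le> inverse \<tau> * a\<^sup>2" "min (inverse \<tau>) (inverse \<sigma>) * b\<^sup>2 \<le> inverse \<sigma> * b\<^sup>2"
    by (auto intro!: mult_right_mono)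
  then have "min (inverse \<tau>) (inverse \<sigma>) * (a\<^sup>2 + b\<^sup>2) \<le> a\<^sup>2 / \<tau> + b\<^sup>2 / \<sigma>"
    by (simp add: distrib_left divide_inverse mult.commute)
  then have "(1 - q * k) * (min (inverse \<tau>) (inverse \<sigma>) * (a\<^sup>2 + b\<^sup>2)) \<le> (1 - q * k) * (a\<^sup>2 / \<tau> + b\<^sup>2 / \<sigma>)"
    using sqrt_norm_K by (intro mult_left_mono) (auto simp: q_def k_def)
  moreover have "(norm u)\<^sup>2 = a\<^sup>2 + b\<^sup>2"
    by (simp add: a_def b_def power2_norm_eq_inner inner_prod_def)
  ultimately have "C * (norm u)\<^sup>2 \<le> (1 - q * k) * (a\<^sup>2 / \<tau> + b\<^sup>2 / \<sigma>)"
    by (simp add: C_const_def q_def k_def mult.assoc)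
  also have "\<dots> \<le> inner (M u) u" using 1 2 by (simp add: left_diff_distrib)
  finally show ?thesis .
qed

lemma op_norm_W: "(op_norm (W_op \<tau> \<sigma> K) b)\<^sup>2 = (norm (adjoint (Z_op \<tau> \<sigma> K) b))\<^sup>2 / C"
  using C_pos by (simp add: op_norm_def inner_W_op)

lemma op_norm_M_Lambda:
  "(op_norm (\<lambda>u. M u + Lambda_op L u) b)\<^sup>2 = inner (M b) b + L * (norm (fst b))\<^sup>2"
proof -
  have "inner (M b + Lambda_op L b) b = inner (M b) b + L * (norm (fst b))\<^sup>2"
    by (simp add: inner_add_left Lambda_op_def block_op_def inner_prod_def power2_norm_eq_inner)
  then show ?thesis using M_nonneg[of b] L by (simp add: op_norm_def)
qed

text \<open>
  Young's inequality \<open>2ab \<le> \<epsilon> a\<^sup>2 + b\<^sup>2 / \<epsilon>\<close>, where \<open>C\<close> compares the Euclidean norm with that of \<open>M\<close>.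
\<close>

lemma Z_young:
  assumes "\<epsilon> > 0"
  shows "inner (M w) b - inner (\<Xi> w) b
    \<le> \<epsilon> / 2 * inner (M w) w + 1 / (2 * \<epsilon>) * (op_norm (W_op \<tau> \<sigma> K) b)\<^sup>2"
proof -
  define a z where "a = norm w" and "z = norm (adjoint (Z_op \<tau> \<sigma> K) b)"
  have "inner (M w) b - inner (\<Xi> w) b \<le> a * z"
    unfolding inner_adjoint_Z_op[symmetric] a_def z_def by (rule norm_cauchy_schwarz)
  also have "\<dots> \<le> \<epsilon> / 2 * (C * a\<^sup>2) + 1 / (2 * \<epsilon>) * (z\<^sup>2 / C)"
  proof -
    have "0 \<le> (\<epsilon> * C * a - z)\<^sup>2 / (2 * \<epsilon> * C)" using assms C_pos by simp
    also have "\<dots> = \<epsilon> / 2 * (C * a\<^sup>2) + 1 / (2 * \<epsilon>) * (z\<^sup>2 / C) - a * z"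
      using assms C_pos by (simp add: field_simps power2_eq_square)
    finally show ?thesis by simp
  qed
  also have "\<dots> \<le> \<epsilon> / 2 * inner (M w) w + 1 / (2 * \<epsilon>) * (z\<^sup>2 / C)"
    using assms M_ge_C[of w] by (simp add: a_def mult_left_mono)
  finally show ?thesis by (simp add: op_norm_W z_def)
qed

subsection \<open>The tilted objective\<close>

lemma tilted_finite_iff: "\<bar>J s u\<bar> \<noteq> \<infinity> \<longleftrightarrow> \<Gamma> u \<noteq> \<infinity>"
  using Gbar_not_MInf[of u] by (cases "\<Gamma> u") (auto simp: tilted_objective_def)

lemma econvex_tilted: "econvex (J s)"
  unfolding tilted_objective_def[abs_def]
proof (rule econvex_add_convex[OF econvex_Gbar Gbar_not_MInf])
  fix u w :: "'x \<times> 'y" and t :: real assume t: "0 < t" "t < 1"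
  show "Ebar E ((1 - t) *\<^sub>R u + t *\<^sub>R w) + inner s ((1 - t) *\<^sub>R u + t *\<^sub>R w)
      \<le> (1 - t) * (Ebar E u + inner s u) + t * (Ebar E w + inner s w)"
    using E_convex[OF t, of "fst u" "fst w"] by (simp add: Ebar_def inner_add_right distrib_left)
qed

text \<open>
  The vector \<open>g + \<nabla>E u + s\<close> is a subgradient of the tilted objective.
\<close>

lemma tilted_subgradient_inequality:
  assumes g: "g \<in> subdiff \<Gamma> u"
  shows "J s u + ereal (inner (g + grad (Ebar E) u + s) (z - u)) \<le> J s z"
proof -
  have "\<Gamma> u + ereal (inner g (z - u)) \<le> \<Gamma> z" "\<bar>\<Gamma> u\<bar> \<noteq> \<infinity>"
    using subdiffD[OF g] subdiff_finite[OF g] by auto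
  then show ?thesis
    using Ebar_gradient_inequality[of u z]
    by (cases "\<Gamma> u"; cases "\<Gamma> z")
      (auto simp: tilted_objective_def inner_add_left inner_diff_right)
qed

subsection \<open>The primal-dual step\<close>

text \<open>
  The off-diagonal blocks of \<open>M\<close> turn the implicit term \<open>K\<^sup>* y\<^sub>+\<close> of \<open>\<Xi>\<close> into the explicit \<open>K\<^sup>* y\<close>, and
  \<open>K x\<^sub>+\<close> into the extrapolation \<open>K (2 x\<^sub>+ - x)\<close>. This decouples the inclusion into two proximal maps
  that can be evaluated one after the other.
\<close>

lemma pd_step_inclusion:
  fixes u :: "'x \<times> 'y"
  defines "p \<equiv> pd_step F E G K \<tau> \<sigma> u"
  obtains q where "q \<in> subdiff \<Gamma> p" "q + \<Xi> p + grad (Ebar E) u + M (p - u) = 0"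
proof -
  define x' where "x' = prox (\<lambda>z. ereal \<tau> * F z) (fst u - \<tau> *\<^sub>R (grad E (fst u) + badjoint K (snd u)))"
  define y' where "y' = prox (\<lambda>z. ereal \<sigma> * fenchel_conj G z)
      (snd u + \<sigma> *\<^sub>R blinfun_apply K (2 *\<^sub>R x' - fst u))"
  have p: "p = (x', y')" by (simp add: p_def pd_step_def Let_def x'_def y'_def)
  define a where "a = (1 / \<tau>) *\<^sub>R (fst u - \<tau> *\<^sub>R (grad E (fst u) + badjoint K (snd u)) - x')"
  define b where "b = (1 / \<sigma>) *\<^sub>R (snd u + \<sigma> *\<^sub>R blinfun_apply K (2 *\<^sub>R x' - fst u) - y')"
  have a: "a \<in> subdiff F x'"
    unfolding a_def x'_def by (rule prox_scaled_subdiff[OF F_pcl \<tau>])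
  have b: "b \<in> subdiff (fenchel_conj G) y'"
    unfolding b_def y'_def by (rule prox_scaled_subdiff[OF proper_convex_lsc_fenchel_conj[OF G_pcl] \<sigma>])
  have fin: "\<bar>F x'\<bar> \<noteq> \<infinity>" "\<bar>fenchel_conj G y'\<bar> \<noteq> \<infinity>" using a b by (auto simp: subdiff_def)
  have "\<Gamma> p + ereal (inner (a, b) (z - p)) \<le> \<Gamma> z" for z
  proof -
    have "F x' + ereal (inner a (fst z - x')) \<le> F (fst z)"
      "fenchel_conj G y' + ereal (inner b (snd z - y')) \<le> fenchel_conj G (snd z)"
      using a b unfolding subdiff_def by blast+
    from add_mono[OF this] fin show ?thesis
      by (cases "F x'"; cases "fenchel_conj G y'")
        (auto simp: Gbar_def p inner_prod_def add_ac)
  qed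
  moreover have "\<bar>\<Gamma> p\<bar> \<noteq> \<infinity>"
    using fin by (cases "F x'"; cases "fenchel_conj G y'") (auto simp: Gbar_def p)
  ultimately have "(a, b) \<in> subdiff \<Gamma> p" by (simp add: subdiff_def)
  moreover have ia: "inner a w = inner (fst u) w / \<tau> - inner (grad E (fst u)) w
      - inner (snd u) (blinfun_apply K w) - inner x' w / \<tau>" for w
    using \<tau> by (simp add: a_def inner_diff_left inner_add_left badjoint_inner field_simps)
  have ib: "inner b w = inner (snd u) w / \<sigma> + 2 * inner w (blinfun_apply K x')
      - inner w (blinfun_apply K (fst u)) - inner y' w / \<sigma>" for w
    using \<sigma> by (simp add: b_def inner_diff_left inner_add_left blinfun.diff_right blinfun.scaleR_right
        inner_commute[of "blinfun_apply K x'" w] inner_commute[of "blinfun_apply K (fst u)" w] field_simps)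
  \<comment> \<open>The adjoint of \<open>K\<close> is known only through inner products, so the identity is tested with all \<open>w\<close>.\<close>
  have "inner ((a, b) + \<Xi> p + grad (Ebar E) u + M (p - u)) w = 0" for w
    unfolding inner_add_left Xi_op_inner M_op_inner grad_Ebar
    by (simp add: inner_prod_def ia ib p inner_diff_left inner_diff_right
        blinfun.diff_right diff_divide_distrib)
  then have "(a, b) + \<Xi> p + grad (Ebar E) u + M (p - u) = 0"
    using inner_eq_zero_iff by blast
  ultimately show ?thesis by (rule that)
qed

text \<open>
  The single estimate behind both levels. Skew-symmetry replaces \<open>\<Xi> (p - c)\<close> by \<open>\<Xi> (z - c)\<close> when
  tested with \<open>p - z\<close>; the quadratic error of the explicit gradient step is absorbed by
  \<open>\<parallel>p - u\<parallel>\<^sub>M\<^sup>2\<close>, since \<open>M\<close> dominates \<open>\<Lambda>\<close>. On the fine level \<open>c = s = 0\<close> and \<open>z\<close> is a solution; on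
  the coarse level \<open>z = c\<close> is the anchor of the extrapolation, so that the \<open>\<Xi>\<close>-term vanishes.
\<close>

lemma forward_backward_estimate:
  assumes q: "q \<in> subdiff \<Gamma> p"
    and inclusion: "q + \<Xi> (p - c) + grad (Ebar E) u + s + M (p - u) = 0"
  shows "J (s + \<Xi> (z - c)) p + ereal (1 / 2 * (op_norm M (p - z))\<^sup>2)
    \<le> J (s + \<Xi> (z - c)) z + ereal (1 / 2 * (op_norm M (u - z))\<^sup>2)"
proof (cases "\<Gamma> z")
  case (real gz)
  have sub: "\<Gamma> p + ereal (inner q (z - p)) \<le> \<Gamma> z" and "\<bar>\<Gamma> p\<bar> \<noteq> \<infinity>"
    using subdiffD[OF q] subdiff_finite[OF q] by auto
  then obtain gp where gp: "\<Gamma> p = ereal gp" by (cases "\<Gamma> p") auto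
  have 1: "gp + inner q (z - p) \<le> gz" using sub by (simp add: gp real)
  have "inner (q + \<Xi> (p - c) + grad (Ebar E) u + s + M (p - u)) (p - z) = 0"
    unfolding inclusion by simp
  then have 2: "inner q (z - p) = inner (\<Xi> (p - c)) (p - z) + inner (grad (Ebar E) u) (p - z)
      + inner s (p - z) + inner (M (p - u)) (p - z)"
    by (simp add: inner_add_left inner_diff_right)
  have 3: "inner (\<Xi> (p - c)) (p - z) = inner (\<Xi> (z - c)) (p - z)"
    by (simp add: Xi_op_inner inner_diff_left blinfun.diff_right inner_diff_right)
  have 4: "Ebar E p \<le> Ebar E u + inner (grad (Ebar E) u) (p - u) + L / 2 * (norm (fst (p - u)))\<^sup>2"
    by (rule Ebar_descent)
  have 5: "Ebar E u + inner (grad (Ebar E) u) (z - u) \<le> Ebar E z"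
    by (rule Ebar_gradient_inequality)
  have 6: "inner (grad (Ebar E) u) (p - z) = inner (grad (Ebar E) u) (p - u) - inner (grad (Ebar E) u) (z - u)"
    by (simp add: inner_diff_right)
  have "gp + (Ebar E p + inner s p + inner (\<Xi> (z - c)) p) + 1 / 2 * inner (M (p - z)) (p - z)
      \<le> gz + (Ebar E z + inner s z + inner (\<Xi> (z - c)) z) + 1 / 2 * inner (M (u - z)) (u - z)"
    using 1 2 3 4 5 6 M_op_three_point[of \<tau> \<sigma> K p u z] M_ge_Lambda[of "p - u"]
      inner_diff_right[of s p z] inner_diff_right[of "\<Xi> (z - c)" p z]
    by linarith
  then show ?thesis
    by (simp add: tilted_objective_def gp real op_norm_M inner_add_left add.assoc)
qed (use Gbar_not_MInf in \<open>auto simp: tilted_objective_def\<close>)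

lemma pd_step_finite: "\<bar>\<Gamma> (pd_step F E G K \<tau> \<sigma> u)\<bar> \<noteq> \<infinity>"
  by (rule pd_step_inclusion[of u]) (auto simp: subdiff_def)

lemma pd_step_estimate:
  fixes u z :: "'x \<times> 'y"
  defines "p \<equiv> pd_step F E G K \<tau> \<sigma> u"
  shows "J (\<Xi> z) p + ereal (1 / 2 * (op_norm M (p - z))\<^sup>2) \<le> J (\<Xi> z) z + ereal (1 / 2 * (op_norm M (u - z))\<^sup>2)"
proof -
  obtain q where "q \<in> subdiff \<Gamma> p" "q + \<Xi> p + grad (Ebar E) u + M (p - u) = 0"
    unfolding p_def by (rule pd_step_inclusion)
  then show ?thesis
    using forward_backward_estimate[of q p 0 u 0 z] by simp
qed

subsection \<open>Coarse iterations decrease the coarse objective\<close>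

text \<open>
  With the fixed anchor \<open>v 0\<close> the distances to \<open>v 0\<close> telescope, starting at zero, and convexity
  passes the bound to the average. With the moving anchor \<open>v j\<close> each step decreases the objective.
\<close>

lemma coarse_iterates_decrease:
  assumes it: "coarse_iterates F E G K \<tau> \<sigma> vtheta m s v" and vtheta: "vtheta \<in> {0, 1}" and m: "m \<ge> 1"
    and fin: "\<bar>\<Gamma> (v 0)\<bar> \<noteq> \<infinity>"
  shows "J s (coarse_output vtheta m v) \<le> J s (v 0)"
proof -
  have step: "\<exists>q. q \<in> subdiff \<Gamma> (v (Suc j)) \<and> q + \<Xi> (v (Suc j) - ((1 - vtheta) *\<^sub>R v j + vtheta *\<^sub>R v 0))
      + grad (Ebar E) (v j) + s + M (v (Suc j) - v j) = 0" if "j < m" for j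
  proof -
    have "0 \<in> (\<lambda>g. g + \<Xi> (v (Suc j) - ((1 - vtheta) *\<^sub>R v j + vtheta *\<^sub>R v 0))
      + grad (Ebar E) (v j) + s + M (v (Suc j) - v j)) ` subdiff \<Gamma> (v (Suc j))"
      using it that unfolding coarse_iterates_def by blast
    then show ?thesis by (metis (no_types, lifting) imageE)
  qed
  show ?thesis
  proof (cases "vtheta = 1")
    case True
    obtain c where c: "J s (v 0) = ereal c"
      using fin by (cases "\<Gamma> (v 0)") (auto simp: tilted_objective_def)
    define a where "a j = 1 / 2 * (op_norm M (v j - v 0))\<^sup>2" for j
    have "J s (v (Suc j)) \<le> ereal (c + (a j - a (Suc j)))" if j: "j < m" for j
    proof -
      obtain q where "q \<in> subdiff \<Gamma> (v (Suc j))"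
        "q + \<Xi> (v (Suc j) - v 0) + grad (Ebar E) (v j) + s + M (v (Suc j) - v j) = 0"
        using step[OF j] True by auto
      from forward_backward_estimate[OF this, of "v 0"]
      have "J s (v (Suc j)) + ereal (a (Suc j)) \<le> J s (v 0) + ereal (a j)"
        by (simp add: a_def Xi_op_zero)
      then show ?thesis unfolding c
        by (cases "J s (v (Suc j))") auto
    qed
    then have "J s ((1 / real m) *\<^sub>R (\<Sum>j<m. v (Suc j)))
        \<le> ereal ((1 / real m) * (\<Sum>j<m. c + (a j - a (Suc j))))"
      by (rule econvex_average[OF econvex_tilted _ m])
    also have "(\<Sum>j<m. c + (a j - a (Suc j))) = real m * c + (a 0 - a m)"
      by (simp add: sum.distrib sum_lessThan_telescope')
    also have "ereal ((1 / real m) * (real m * c + (a 0 - a m))) \<le> ereal c"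
    proof -
      have "a 0 = 0" using op_norm_M[of 0] by (simp add: a_def)
      moreover have "0 \<le> a m" by (simp add: a_def)
      ultimately show ?thesis using m by (simp add: field_simps)
    qed
    finally show ?thesis using True by (simp add: coarse_output_def c)
  next
    case False
    then have vtheta0: "vtheta = 0" using vtheta by simp
    have decr: "J s (v (Suc j)) \<le> J s (v j)" if j: "j < m" for j
    proof -
      obtain q where "q \<in> subdiff \<Gamma> (v (Suc j))"
        "q + \<Xi> (v (Suc j) - v j) + grad (Ebar E) (v j) + s + M (v (Suc j) - v j) = 0"
        using step[OF j] vtheta0 by auto
      from forward_backward_estimate[OF this, of "v j"]
      have le: "J s (v (Suc j)) + ereal (1 / 2 * (op_norm M (v (Suc j) - v j))\<^sup>2) \<le> J s (v j)"
        using op_norm_M[of 0] by (simp add: Xi_op_zero)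
      have "J s (v (Suc j)) \<le> J s (v (Suc j)) + ereal (1 / 2 * (op_norm M (v (Suc j) - v j))\<^sup>2)"
        by (cases "J s (v (Suc j))") auto
      with le show ?thesis by (rule order_trans[rotated])
    qed
    have "j \<le> m \<Longrightarrow> J s (v j) \<le> J s (v 0)" for j
    proof (induction j)
      case (Suc j)
      then show ?case using decr[of j] by (meson Suc_leD Suc_le_lessD order_trans)
    qed simp
    then show ?thesis using False by (simp add: coarse_output_def)
  qed
qed

end

lemma bounded_linear_restriction: "bounded_linear (restriction P D)"
  unfolding restriction_def
  by (intro bounded_linear_Pair bounded_linear_compose[OF blinfun.bounded_linear_right] bounded_linear_fst bounded_linear_snd)

lemma inner_prolongation:
  fixes P :: "'x::{real_inner,complete_space} \<Rightarrow>\<^sub>L 'a::real_inner"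
    and D :: "'y::{real_inner,complete_space} \<Rightarrow>\<^sub>L 'b::real_inner"
  shows "inner g (prolongation P D v) = inner (restriction P D g) v"
  unfolding prolongation_def by (rule adjoint_inner[OF bounded_linear_restriction, symmetric])

context saddle_structure
begin

subsection \<open>Coarse corrections\<close>

text \<open>
  By coherence and the choice of the shift, \<open>I\<^sub>h\<^sup>H\<close> maps the elements of the fine subdifferential of the
  objective at \<open>w\<close> into the coarse subdifferential at \<open>v 0\<close>. Decrease of the convex coarse
  objective therefore makes every fine subgradient point away from the correction.
\<close>

lemma coarse_correction_descent:
  fixes P :: "'x \<Rightarrow>\<^sub>L 'a::{real_inner,complete_space}" and D :: "'y \<Rightarrow>\<^sub>L 'b::{real_inner,complete_space}"
  assumes coarse: "saddle_structure FH EH GH KH \<tau>H \<sigma>H LH"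
    and coherent: "coherent F G P D FH GH w"
    and it: "coarse_iterates FH EH GH KH \<tau>H \<sigma>H vtheta m (coarse_shift E K P D EH w) v"
    and v0: "v 0 = restriction P D w" and vtheta: "vtheta \<in> {0, 1}" and m: "m \<ge> 1"
    and g: "g \<in> subdiff \<Gamma> w"
  shows "inner (g + grad (Ebar E) w + \<Xi> w) (prolongation P D (coarse_output vtheta m v - v 0)) \<le> 0"
proof -
  interpret H: saddle_structure FH EH GH KH \<tau>H \<sigma>H LH by (rule coarse)
  let ?R = "restriction P D" and ?s = "coarse_shift E K P D EH w" and ?out = "coarse_output vtheta m v"
  have gH: "?R g \<in> subdiff H.\<Gamma> (v 0)"
    using coherent g unfolding coherent_def v0 by blast
  have "?R (g + grad (Ebar E) w + \<Xi> w) = ?R g + ?R (grad (Ebar E) w + \<Xi> w)"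
    by (simp add: linear_add[OF bounded_linear.linear[OF bounded_linear_restriction]] add.assoc)
  then have R: "?R (g + grad (Ebar E) w + \<Xi> w) = ?R g + grad (Ebar EH) (v 0) + ?s"
    by (simp add: coarse_shift_def v0)
  have "H.J ?s (v 0) + ereal (inner (?R g + grad (Ebar EH) (v 0) + ?s) (?out - v 0)) \<le> H.J ?s ?out"
    by (rule H.tilted_subgradient_inequality[OF gH])
  also have "\<dots> \<le> H.J ?s (v 0)"
    by (rule H.coarse_iterates_decrease[OF it vtheta m subdiff_finite[OF gH]])
  finally have "inner (?R g + grad (Ebar EH) (v 0) + ?s) (?out - v 0) \<le> 0"
    using H.tilted_finite_iff[of ?s "v 0"] subdiff_finite[OF gH]
    by (cases "H.J ?s (v 0)") auto
  then show ?thesis by (simp add: inner_prolongation R)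
qed

text \<open>
  The max formula writes the directional derivative as a supremum over the fine subgradients, each
  of which contributes at most zero.
\<close>

lemma dirderiv_Gbar_add_le_0:
  assumes max: "max_formula \<Gamma> w d" and fin: "\<bar>\<Gamma> w\<bar> \<noteq> \<infinity>" and e: "GDERIV e w :> h"
    and le: "\<And>g. g \<in> subdiff \<Gamma> w \<Longrightarrow> inner (g + h) d \<le> 0"
  shows "dirderiv (\<lambda>u. \<Gamma> u + ereal (e u)) w d \<le> 0"
proof -
  obtain c where c: "\<Gamma> w = ereal c" using fin by (cases "\<Gamma> w") auto
  have "dirderiv \<Gamma> w d \<le> ereal (- inner h d)"
    unfolding max[unfolded max_formula_def]
  proof (rule SUP_least)
    fix g assume "g \<in> subdiff \<Gamma> w"
    from le[OF this] show "ereal (inner g d) \<le> ereal (- inner h d)" by (simp add: inner_add_left)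
  qed
  then have "dirderiv \<Gamma> w d + ereal (inner h d) \<le> ereal (- inner h d) + ereal (inner h d)"
    by (rule add_right_mono)
  then show ?thesis
    using dirderiv_add_GDERIV[OF econvex_Gbar Gbar_not_MInf c e] by (simp add: zero_ereal_def)
qed

lemma dirderiv_Phi_Psi_le_0:
  assumes max: "max_formula \<Gamma> w d" and fin: "\<bar>\<Gamma> w\<bar> \<noteq> \<infinity>"
    and le: "\<And>g. g \<in> subdiff \<Gamma> w \<Longrightarrow> inner (g + grad (Ebar E) w + \<Xi> w) d \<le> 0"
  shows "dirderiv (\<lambda>u. Phi F E G K u w) w d \<le> 0" "dirderiv (\<lambda>u. Psi F E G K u w) w d \<le> 0"
proof -
  have lin: "GDERIV (inner a) w :> a" for a :: "'x \<times> 'y"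
    unfolding gderiv_def by (auto intro!: derivative_eq_intros simp: inner_commute)
  have le': "inner (g + (grad (Ebar E) w + \<Xi> w)) d \<le> 0" if "g \<in> subdiff \<Gamma> w" for g
    using le[OF that] by (simp add: add.assoc)
  have "GDERIV (\<lambda>u. Ebar E u + inner (\<Xi> w) u) w :> grad (Ebar E) w + \<Xi> w"
    unfolding grad_Ebar by (intro GDERIV_add GDERIV_Ebar lin)
  from dirderiv_Gbar_add_le_0[OF max fin this le']
  show "dirderiv (\<lambda>u. Phi F E G K u w) w d \<le> 0"
    by (simp add: Phi_def add.assoc)
  have "GDERIV (\<lambda>u. (Ebar E w - inner (grad (Ebar E) w) w) + (inner (grad (Ebar E) w) u + inner (\<Xi> w) u)) w
      :> 0 + (grad (Ebar E) w + \<Xi> w)"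
    by (intro GDERIV_add GDERIV_const lin)
  then have "GDERIV (\<lambda>u. (Ebar E w - inner (grad (Ebar E) w) w) + (inner (grad (Ebar E) w) u + inner (\<Xi> w) u)) w
      :> grad (Ebar E) w + \<Xi> w" by simp
  from dirderiv_Gbar_add_le_0[OF max fin this le']
  show "dirderiv (\<lambda>u. Psi F E G K u w) w d \<le> 0"
    by (simp add: Psi_def add.assoc inner_diff_right algebra_simps)
qed

text \<open>
  The linearized condition implies the exact one: the descent lemma pays for replacing \<open>E\<close> by its
  linearization with the additional term \<open>\<parallel>\<theta> d\<parallel>\<^sub>\<Lambda>\<^sup>2 / 2\<close>.
\<close>

lemma line_search_decrease:
  assumes fin: "\<bar>\<Gamma> w\<bar> \<noteq> \<infinity>"
    and search: "line_search_Phi F E G K \<tau> \<sigma> \<kappa> \<epsilon> \<rho> w d \<theta> \<or> line_search_Psi F E G K \<tau> \<sigma> L \<kappa> \<epsilon> \<rho> w d \<theta>"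
    and \<kappa>: "0 < \<kappa>" and \<theta>: "0 \<le> \<theta>"
    and descent: "0 < \<theta> \<Longrightarrow> dirderiv (\<lambda>u. Phi F E G K u w) w d \<le> 0"
      "0 < \<theta> \<Longrightarrow> dirderiv (\<lambda>u. Psi F E G K u w) w d \<le> 0"
  shows "J (\<Xi> w) (w + \<theta> *\<^sub>R d) + ereal (1 / 2 * (op_norm M (\<theta> *\<^sub>R d))\<^sup>2
            + 1 / (2 * \<epsilon>) * (op_norm (W_op \<tau> \<sigma> K) (\<theta> *\<^sub>R d))\<^sup>2)
    \<le> J (\<Xi> w) w + ereal (\<rho> / 2)"
proof -
  define b where "b = \<theta> *\<^sub>R d"
  define W where "W = 1 / (2 * \<epsilon>) * (op_norm (W_op \<tau> \<sigma> K) b)\<^sup>2"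
  obtain c where c: "\<Gamma> w = ereal c" using fin by (cases "\<Gamma> w") auto
  have drop: "x + ereal (\<kappa> * \<theta>) * D + ereal (\<rho> / 2) \<le> x + ereal (\<rho> / 2)"
    if "0 < \<theta> \<Longrightarrow> D \<le> 0" for x D :: ereal
  proof -
    have "ereal (\<kappa> * \<theta>) * D \<le> 0"
    proof (cases "\<theta> = 0")
      case False
      then have "0 < \<theta>" using \<theta> by simp
      then have "ereal (\<kappa> * \<theta>) * D \<le> ereal (\<kappa> * \<theta>) * 0"
        using that \<kappa> by (intro ereal_mult_left_mono) auto
      then show ?thesis by simp
    qed (simp add: zero_ereal_def[symmetric])
    then have "x + ereal (\<kappa> * \<theta>) * D \<le> x + 0" by (rule add_left_mono)
    then show ?thesis by (simp add: add_right_mono)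
  qed
  from search show ?thesis
  proof
    assume "line_search_Phi F E G K \<tau> \<sigma> \<kappa> \<epsilon> \<rho> w d \<theta>"
    then have "J (\<Xi> w) (w + b) + ereal (1 / 2 * (op_norm M b)\<^sup>2) + ereal W
        \<le> J (\<Xi> w) w + ereal (\<kappa> * \<theta>) * dirderiv (\<lambda>u. Phi F E G K u w) w d + ereal (\<rho> / 2)"
      unfolding line_search_Phi_def b_def[symmetric] W_def[symmetric] by (simp add: Phi_eq_tilted)
    also have "\<dots> \<le> J (\<Xi> w) w + ereal (\<rho> / 2)" by (rule drop[OF descent(1)])
    finally show ?thesis unfolding b_def[symmetric] W_def[symmetric] by (simp add: add.assoc)
  next
    assume "line_search_Psi F E G K \<tau> \<sigma> L \<kappa> \<epsilon> \<rho> w d \<theta>"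
    then have "Psi F E G K (w + b) w + ereal (1 / 2 * (op_norm (\<lambda>u. M u + Lambda_op L u) b)\<^sup>2) + ereal W
        \<le> Psi F E G K w w + ereal (\<kappa> * \<theta>) * dirderiv (\<lambda>u. Psi F E G K u w) w d + ereal (\<rho> / 2)"
      unfolding line_search_Psi_def b_def[symmetric] W_def[symmetric] .
    also have "\<dots> \<le> Psi F E G K w w + ereal (\<rho> / 2)" by (rule drop[OF descent(2)])
    finally have le: "Psi F E G K (w + b) w + ereal (1 / 2 * (op_norm (\<lambda>u. M u + Lambda_op L u) b)\<^sup>2) + ereal W
        \<le> Psi F E G K w w + ereal (\<rho> / 2)" .
    then obtain c' where c': "\<Gamma> (w + b) = ereal c'"
      using Gbar_not_MInf[of "w + b"] by (cases "\<Gamma> (w + b)") (auto simp: Psi_def c)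
    have "Ebar E (w + b) \<le> Ebar E w + inner (grad (Ebar E) w) b + L / 2 * (norm (fst b))\<^sup>2"
      using Ebar_descent[of "w + b" w] by simp
    moreover have "c' + Ebar E w + inner (grad (Ebar E) w) b + inner (\<Xi> w) (w + b)
        + 1 / 2 * (inner (M b) b + L * (norm (fst b))\<^sup>2) + W \<le> c + Ebar E w + inner (\<Xi> w) w + \<rho> / 2"
      using le by (simp add: Psi_def c c' op_norm_M_Lambda)
    ultimately have "c' + (Ebar E (w + b) + inner (\<Xi> w) (w + b)) + (1 / 2 * inner (M b) b + W)
        \<le> c + (Ebar E w + inner (\<Xi> w) w) + \<rho> / 2"
      by argo
    then show ?thesis
      unfolding b_def[symmetric] W_def[symmetric]
      by (simp add: tilted_objective_def c c' op_norm_M)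
  qed
qed

text \<open>
  Changing the reference point of the objective from \<open>w\<close> to \<open>z\<close> and expanding \<open>\<parallel>w + b - z\<parallel>\<^sub>M\<^sup>2\<close> leave
  the cross term \<open>\<langle>(M - \<Xi>) (w - z), b\<rangle>\<close>, which Young's inequality splits.
\<close>

lemma correction_estimate:
  assumes fin: "\<bar>\<Gamma> w\<bar> \<noteq> \<infinity>" and \<epsilon>: "0 < \<epsilon>"
    and decrease: "J (\<Xi> w) (w + b) + ereal (1 / 2 * (op_norm M b)\<^sup>2
            + 1 / (2 * \<epsilon>) * (op_norm (W_op \<tau> \<sigma> K) b)\<^sup>2) \<le> J (\<Xi> w) w + ereal (\<rho> / 2)"
  shows "J (\<Xi> z) (w + b) + ereal (1 / 2 * (op_norm M (w + b - z))\<^sup>2)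
    \<le> J (\<Xi> z) w + ereal (1 / 2 * ((1 + \<epsilon>) * (op_norm M (w - z))\<^sup>2 + \<rho>))"
proof -
  obtain c where c: "\<Gamma> w = ereal c" using fin by (cases "\<Gamma> w") auto
  obtain c' where c': "\<Gamma> (w + b) = ereal c'"
    using decrease Gbar_not_MInf[of "w + b"] by (cases "\<Gamma> (w + b)") (auto simp: tilted_objective_def c)
  define W where "W = 1 / (2 * \<epsilon>) * (op_norm (W_op \<tau> \<sigma> K) b)\<^sup>2"
  have "w + b - z = (w - z) + b" by simp
  then have 1: "inner (M (w + b - z)) (w + b - z)
      = inner (M (w - z)) (w - z) + 2 * inner (M (w - z)) b + inner (M b) b"
    by (simp only: M_op_add)
  have 2: "inner (M (w - z)) b - inner (\<Xi> (w - z)) b \<le> \<epsilon> / 2 * inner (M (w - z)) (w - z) + W"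
    unfolding W_def by (rule Z_young[OF \<epsilon>])
  have 3: "inner (\<Xi> (w - z)) b = inner (\<Xi> w) b - inner (\<Xi> z) b"
    by (simp add: Xi_op_inner inner_diff_left inner_diff_right blinfun.diff_right)
  have 4: "c' + (Ebar E (w + b) + inner (\<Xi> w) (w + b)) + (1 / 2 * inner (M b) b + W)
      \<le> c + (Ebar E w + inner (\<Xi> w) w) + \<rho> / 2"
    using decrease by (simp add: tilted_objective_def c c' op_norm_M W_def)
  have "c' + (Ebar E (w + b) + inner (\<Xi> z) (w + b)) + 1 / 2 * inner (M (w + b - z)) (w + b - z)
      \<le> c + (Ebar E w + inner (\<Xi> z) w) + (1 / 2 * inner (M (w - z)) (w - z)
          + \<epsilon> / 2 * inner (M (w - z)) (w - z) + \<rho> / 2)"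
    using 1 2 3 4 inner_add_right[of "\<Xi> w" w b] inner_add_right[of "\<Xi> z" w b] by linarith
  then show ?thesis
    by (simp add: tilted_objective_def c c' op_norm_M distrib_right add_divide_distrib)
qed

lemma solution_minimizes:
  assumes "z \<in> primal_dual_solutions F E G K"
  shows "J (\<Xi> z) z \<le> J (\<Xi> z) u" "\<bar>J (\<Xi> z) z\<bar> \<noteq> \<infinity>"
proof -
  obtain g where g: "g \<in> subdiff \<Gamma> z" and 0: "g + grad (Ebar E) z + \<Xi> z = 0"
    using assms unfolding primal_dual_solutions_def by (auto simp: image_iff)
  show "J (\<Xi> z) z \<le> J (\<Xi> z) u"
    using tilted_subgradient_inequality[OF g, of "\<Xi> z" u] 0 by simp
  show "\<bar>J (\<Xi> z) z\<bar> \<noteq> \<infinity>"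
    using subdiff_finite[OF g] by (subst tilted_finite_iff) auto
qed

text \<open>
  The correction may enlarge the bound only by the factor \<open>1 + \<epsilon>\<close> on \<open>\<parallel>w - z\<parallel>\<^sub>M\<^sup>2\<close>, where \<open>w\<close> is the point
  before the correction. Since the gap at \<open>w\<close> is nonnegative, \<open>w\<close> is no farther from the solution \<open>z\<close>
  than \<open>u k\<close>, so the factor can be charged to \<open>\<parallel>u k - z\<parallel>\<^sub>M\<^sup>2\<close> and the estimate becomes recursive.
\<close>

lemma pdmcc_iteration_estimate:
  fixes P :: "'x \<Rightarrow>\<^sub>L 'a::{real_inner,complete_space}" and D :: "'y \<Rightarrow>\<^sub>L 'b::{real_inner,complete_space}"
  assumes run: "pdmcc_run F E G K \<tau> \<sigma> L P D FH EH GH KH \<tau>H \<sigma>H \<kappa> m vtheta I \<epsilon> \<rho> u v d \<theta>"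
    and coarse: "k \<in> I \<Longrightarrow> saddle_structure (FH k) EH (GH k) KH \<tau>H \<sigma>H LH"
    and coherence: "k \<in> I \<Longrightarrow> coherent F G P D (FH k) (GH k) (pd_step F E G K \<tau> \<sigma> (u k))"
    and parameters: "k \<in> I \<Longrightarrow> 0 < \<epsilon> k \<and> 0 < \<rho> k"
    and \<kappa>: "0 < \<kappa>" and m: "m \<ge> 1" and vtheta: "vtheta \<in> {0, 1}"
    and max_rule: "k \<in> I \<Longrightarrow> \<theta> k > 0 \<Longrightarrow> max_formula \<Gamma> (pd_step F E G K \<tau> \<sigma> (u k)) (d k)"
    and z: "z \<in> primal_dual_solutions F E G K"
  shows "J (\<Xi> z) (u (Suc k)) + ereal (1 / 2 * (op_norm M (u (Suc k) - z))\<^sup>2)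
    \<le> J (\<Xi> z) z + ereal (1 / 2 * ((1 + (if k \<in> I then \<epsilon> k else 0)) * (op_norm M (u k - z))\<^sup>2
        + (if k \<in> I then \<rho> k else 0)))"
proof -
  define w where "w = pd_step F E G K \<tau> \<sigma> (u k)"
  define s where "s = coarse_shift E K P D EH w"
  have fin: "\<bar>\<Gamma> w\<bar> \<noteq> \<infinity>" unfolding w_def by (rule pd_step_finite)
  have est: "J (\<Xi> z) w + ereal (1 / 2 * (op_norm M (w - z))\<^sup>2) \<le> J (\<Xi> z) z + ereal (1 / 2 * (op_norm M (u k - z))\<^sup>2)"
    unfolding w_def by (rule pd_step_estimate)
  obtain j where j: "J (\<Xi> z) z = ereal j"
    using solution_minimizes(2)[OF z] by (cases "J (\<Xi> z) z") auto
  obtain jw where jw: "J (\<Xi> z) w = ereal jw"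
    using tilted_finite_iff[of "\<Xi> z" w] fin by (cases "J (\<Xi> z) w") auto
  have "j \<le> jw" using solution_minimizes(1)[OF z, of w] by (simp add: j jw)
  moreover have est': "jw + 1 / 2 * (op_norm M (w - z))\<^sup>2 \<le> j + 1 / 2 * (op_norm M (u k - z))\<^sup>2"
    using est by (simp add: j jw)
  ultimately have dist: "(op_norm M (w - z))\<^sup>2 \<le> (op_norm M (u k - z))\<^sup>2" by simp
  have plain: ?thesis if "u (Suc k) = w"
  proof -
    have "jw + 1 / 2 * (op_norm M (w - z))\<^sup>2
        \<le> j + 1 / 2 * ((1 + (if k \<in> I then \<epsilon> k else 0)) * (op_norm M (u k - z))\<^sup>2 + (if k \<in> I then \<rho> k else 0))"
    proof (cases "k \<in> I")
      case True
      then have "0 \<le> \<epsilon> k * (op_norm M (u k - z))\<^sup>2" "0 \<le> \<rho> k" using parameters by auto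
      then show ?thesis using est' True by (simp add: distrib_right add_divide_distrib)
    qed (use est' in simp)
    then show ?thesis by (simp add: that j jw)
  qed
  note run_k = run[unfolded pdmcc_run_def Let_def, rule_format, of k, folded w_def, folded s_def]
  show ?thesis
  proof (cases "k \<in> I \<and> \<not> coarse_solves (FH k) EH (GH k) s (v k 0)")
    case False
    then have "u (Suc k) = w" using run_k by (cases "k \<in> I") auto
    then show ?thesis by (rule plain)
  next
    case True
    then have k: "k \<in> I" by simp
    have v0: "v k 0 = restriction P D w"
      and it: "coarse_iterates (FH k) EH (GH k) KH \<tau>H \<sigma>H vtheta m s (v k)"
      and d: "d k = prolongation P D (coarse_output vtheta m (v k) - v k 0)" and \<theta>: "0 \<le> \<theta> k"
      and search: "line_search_Phi F E G K \<tau> \<sigma> \<kappa> (\<epsilon> k) (\<rho> k) w (d k) (\<theta> k)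
        \<or> line_search_Psi F E G K \<tau> \<sigma> L \<kappa> (\<epsilon> k) (\<rho> k) w (d k) (\<theta> k)"
      and update: "u (Suc k) = w + \<theta> k *\<^sub>R d k"
      using run_k True by auto
    have le: "inner (g + grad (Ebar E) w + \<Xi> w) (d k) \<le> 0" if "g \<in> subdiff \<Gamma> w" for g
      unfolding d
      by (rule coarse_correction_descent[OF coarse[OF k] coherence[OF k, folded w_def] it[unfolded s_def] v0 vtheta m that])
    have descent: "dirderiv (\<lambda>u. Phi F E G K u w) w (d k) \<le> 0" "dirderiv (\<lambda>u. Psi F E G K u w) w (d k) \<le> 0"
      if "0 < \<theta> k"
      using dirderiv_Phi_Psi_le_0[OF max_rule[OF k that, folded w_def] fin le] by auto
    have \<epsilon>: "0 < \<epsilon> k" using parameters[OF k] by simp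
    have "J (\<Xi> z) (u (Suc k)) + ereal (1 / 2 * (op_norm M (u (Suc k) - z))\<^sup>2)
      \<le> J (\<Xi> z) w + ereal (1 / 2 * ((1 + \<epsilon> k) * (op_norm M (w - z))\<^sup>2 + \<rho> k))"
      unfolding update
      by (rule correction_estimate[OF fin \<epsilon> line_search_decrease[OF fin search \<kappa> \<theta> descent]])
    also have "\<dots> \<le> J (\<Xi> z) z + ereal (1 / 2 * ((1 + \<epsilon> k) * (op_norm M (u k - z))\<^sup>2 + \<rho> k))"
    proof -
      have "\<epsilon> k * (op_norm M (w - z))\<^sup>2 \<le> \<epsilon> k * (op_norm M (u k - z))\<^sup>2"
        using dist \<epsilon> by (intro mult_left_mono) auto
      then show ?thesis using est' by (simp add: j jw distrib_right add_divide_distrib)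
    qed
    finally show ?thesis using k by simp
  qed
qed

end

section \<open>Summation of the errors\<close>

text \<open>
  A discrete Gronwall argument bounds \<open>a k\<close> by \<open>p (a 0 + R)\<close>; inserting this into the terms
  \<open>e k * a k\<close> of the telescoped recursion gives the claim.
\<close>

lemma sum_le_of_perturbed_recursion:
  fixes a g e r :: "nat \<Rightarrow> real"
  assumes nonneg: "\<And>k. 0 \<le> a k" "\<And>k. 0 \<le> g k" "\<And>k. 0 \<le> e k" "\<And>k. 0 \<le> r k"
    and step: "\<And>k. a (Suc k) + 2 * g k \<le> (1 + e k) * a k + r k"
    and p: "\<And>n. (\<Prod>k<n. 1 + e k) \<le> p" and S: "\<And>n. (\<Sum>k<n. e k) \<le> S" and R: "\<And>n. (\<Sum>k<n. r k) \<le> R"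
  shows "2 * (\<Sum>k<N. g k) \<le> (S * p + 1) * (a 0 + R)"
proof -
  have prod1: "1 \<le> (\<Prod>k<n. 1 + e k)" for n
    using nonneg(3) by (intro prod_ge_1) auto
  have R0: "0 \<le> R" and p0: "0 \<le> p" using R[of 0] p[of 0] by auto
  have gronwall: "a n \<le> (\<Prod>k<n. 1 + e k) * (a 0 + (\<Sum>k<n. r k))" for n
  proof (induction n)
    case (Suc n)
    have "a (Suc n) \<le> (1 + e n) * a n + r n" using step[of n] nonneg(2)[of n] by simp
    also have "\<dots> \<le> (1 + e n) * ((\<Prod>k<n. 1 + e k) * (a 0 + (\<Sum>k<n. r k))) + (\<Prod>k<Suc n. 1 + e k) * r n"
      using Suc nonneg(3)[of n] nonneg(4)[of n] mult_right_mono[OF prod1[of "Suc n"] nonneg(4)[of n]]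
      by (intro add_mono mult_left_mono) auto
    also have "\<dots> = (\<Prod>k<Suc n. 1 + e k) * (a 0 + (\<Sum>k<Suc n. r k))"
      by (simp add: algebra_simps)
    finally show ?case .
  qed simp
  have bound: "a n \<le> p * (a 0 + R)" for n
    by (rule order_trans[OF gronwall], intro mult_mono p p0 add_left_mono R add_nonneg_nonneg sum_nonneg nonneg)
  have "a N + 2 * (\<Sum>k<N. g k) \<le> a 0 + (\<Sum>k<N. e k * a k) + (\<Sum>k<N. r k)"
  proof (induction N)
    case (Suc N)
    then show ?case using step[of N] by (simp add: algebra_simps)
  qed simp
  also have "(\<Sum>k<N. e k * a k) \<le> (\<Sum>k<N. e k * (p * (a 0 + R)))"
    by (intro sum_mono mult_left_mono bound nonneg)
  also have "\<dots> = (\<Sum>k<N. e k) * (p * (a 0 + R))"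
    by (simp only: sum_distrib_right)
  also have "\<dots> \<le> S * (p * (a 0 + R))"
    using S[of N] p0 R0 nonneg(1)[of 0] by (intro mult_right_mono) auto
  finally show ?thesis
    using R[of N] nonneg(1)[of N] by (simp add: algebra_simps)
qed

lemma parameter_sums:
  assumes "parameter_assumption I \<epsilon> \<rho>"
  shows "(\<Prod>k<n. 1 + (if k \<in> I then \<epsilon> k else 0)) \<le> kappa_eps I \<epsilon>"
    and "(\<Sum>k<n. if k \<in> I then \<epsilon> k else 0) \<le> infsum \<epsilon> I"
    and "(\<Sum>k<n. if k \<in> I then \<rho> k else 0) \<le> infsum \<rho> I"
proof -
  have pos: "\<And>k. k \<in> I \<Longrightarrow> 0 \<le> \<epsilon> k" "\<And>k. k \<in> I \<Longrightarrow> 0 \<le> \<rho> k"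
    and summable: "\<epsilon> summable_on I" "\<rho> summable_on I"
    and conv: "convergent_prod (\<lambda>k. if k \<in> I then 1 + \<epsilon> k else 1)"
    using assms by (auto simp: parameter_assumption_def less_imp_le)
  have "(\<Prod>k<n. if k \<in> I then 1 + \<epsilon> k else 1) \<le> kappa_eps I \<epsilon>"
    unfolding kappa_eps_def using pos(1)
    by (intro prod_le_prodinf[OF convergent_prod_has_prod[OF conv]]) (auto simp: add_nonneg_nonneg)
  then show "(\<Prod>k<n. 1 + (if k \<in> I then \<epsilon> k else 0)) \<le> kappa_eps I \<epsilon>"
    by (simp add: if_distrib[of "\<lambda>x. 1 + x"] cong: if_cong)
  show "(\<Sum>k<n. if k \<in> I then \<epsilon> k else 0) \<le> infsum \<epsilon> I"
    using finite_sum_le_infsum[OF summable(1), of "{..<n} \<inter> I"] pos(1) by (simp add: sum.inter_restrict)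
  show "(\<Sum>k<n. if k \<in> I then \<rho> k else 0) \<le> infsum \<rho> I"
    using finite_sum_le_infsum[OF summable(2), of "{..<n} \<inter> I"] pos(2) by (simp add: sum.inter_restrict)
qed

section \<open>The ergodic gap estimate\<close>

theorem corollary6p6:
  fixes F :: "'x::{real_inner,complete_space} \<Rightarrow> ereal"
    and E :: "'x \<Rightarrow> real"
    and G :: "'y::{real_inner,complete_space} \<Rightarrow> ereal"
    and K :: "'x \<Rightarrow>\<^sub>L 'y"
    and \<tau> \<sigma> L :: real
    and P :: "'x \<Rightarrow>\<^sub>L 'a::{real_inner,complete_space}"
    and D :: "'y \<Rightarrow>\<^sub>L 'b::{real_inner,complete_space}"
    and FH :: "nat \<Rightarrow> 'a \<Rightarrow> ereal"
    and EH :: "'a \<Rightarrow> real"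
    and GH :: "nat \<Rightarrow> 'b \<Rightarrow> ereal"
    and KH :: "'a \<Rightarrow>\<^sub>L 'b"
    and \<tau>H \<sigma>H LH :: real
    and \<kappa> vtheta :: real
    and m :: nat
    and I :: "nat set"
    and \<epsilon> \<rho> :: "nat \<Rightarrow> real"
    and u :: "nat \<Rightarrow> 'x \<times> 'y"
    and v :: "nat \<Rightarrow> nat \<Rightarrow> 'a \<times> 'b"
    and d :: "nat \<Rightarrow> 'x \<times> 'y"
    and \<theta> :: "nat \<Rightarrow> real"
    and u_hat :: "'x \<times> 'y"
  assumes fine: "structure_assumption F E G K \<tau> \<sigma> L"
    and coarse: "\<And>k. k \<in> I \<Longrightarrow> structure_assumption (FH k) EH (GH k) KH \<tau>H \<sigma>H LH"
    and coherence: "\<And>k. k \<in> I \<Longrightarrow> coherent F G P D (FH k) (GH k) (pd_step F E G K \<tau> \<sigma> (u k))"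
    and parameters: "parameter_assumption I \<epsilon> \<rho>"
    and kappa: "0 < \<kappa>" "\<kappa> < 1"
    and m: "m \<ge> 1"
    and vartheta: "vtheta \<in> {0, 1}"
    and run: "pdmcc_run F E G K \<tau> \<sigma> L P D FH EH GH KH \<tau>H \<sigma>H \<kappa> m vtheta I \<epsilon> \<rho> u v d \<theta>"
    and max_rule: "\<And>k. k \<in> I \<Longrightarrow> \<theta> k > 0 \<Longrightarrow>
                     max_formula (Gbar F G) (pd_step F E G K \<tau> \<sigma> (u k)) (d k)"
    and solution: "u_hat \<in> primal_dual_solutions F E G K"
  shows "(\<forall>N\<ge>1. lagrangian_gap F E G K (ergodic u N) u_hat
            \<le> ereal ((infsum \<epsilon> I * kappa_eps I \<epsilon> + 1) / (2 * real N)
                * ((op_norm (M_op \<tau> \<sigma> K) (u 0 - u_hat))\<^sup>2 + infsum \<rho> I)))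
       \<and> (\<lambda>N. lagrangian_gap F E G K (ergodic u N) u_hat) \<longlonglongrightarrow> 0
       \<and> (\<forall>N\<ge>1. \<bar>lagrangian_gap F E G K (ergodic u N) u_hat\<bar> \<noteq> \<infinity>)
       \<and> (\<lambda>N. real_of_ereal (lagrangian_gap F E G K (ergodic u N) u_hat)) \<in> O(\<lambda>N. 1 / real N)"
proof -
  interpret saddle_structure F E G K \<tau> \<sigma> L by standard (rule fine)
  let ?J = "J (\<Xi> u_hat)"
  let ?gap = "\<lambda>N. lagrangian_gap F E G K (ergodic u N) u_hat"
  have coarse_saddle: "saddle_structure (FH k) EH (GH k) KH \<tau>H \<sigma>H LH" if "k \<in> I" for k
    by standard (rule coarse[OF that])
  define e r where "e k = (if k \<in> I then \<epsilon> k else 0)" and "r k = (if k \<in> I then \<rho> k else 0)" for k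
  have pos: "0 < \<epsilon> k \<and> 0 < \<rho> k" if "k \<in> I" for k
    using parameters that by (simp add: parameter_assumption_def)
  define a where "a k = (op_norm M (u k - u_hat))\<^sup>2" for k
  obtain j where j: "?J u_hat = ereal j"
    using solution_minimizes(2)[OF solution] by (cases "?J u_hat") auto
  have j_le: "ereal j \<le> ?J z" for z
    using solution_minimizes(1)[OF solution, of z] by (simp add: j)
  have iteration: "?J (u (Suc k)) + ereal (1 / 2 * a (Suc k)) \<le> ereal j + ereal (1 / 2 * ((1 + e k) * a k + r k))" for k
    using pdmcc_iteration_estimate[OF run coarse_saddle coherence pos kappa(1) m vartheta max_rule solution]
    unfolding a_def e_def r_def j by blast
  have "\<exists>g. ?J (u (Suc k)) = ereal (j + g)" for k
    using iteration[of k] j_le[of "u (Suc k)"]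
    by (cases "?J (u (Suc k))") (auto intro: exI[of _ "_ - j"])
  then obtain g where g: "\<And>k. ?J (u (Suc k)) = ereal (j + g k)" by metis
  have g0: "0 \<le> g k" for k using j_le[of "u (Suc k)"] by (simp add: g)
  have step: "a (Suc k) + 2 * g k \<le> (1 + e k) * a k + r k" for k
    using iteration[of k] by (simp add: g)
  define B where "B = (infsum \<epsilon> I * kappa_eps I \<epsilon> + 1) * (a 0 + infsum \<rho> I)"
  have sum_g: "2 * (\<Sum>k<N. g k) \<le> B" for N
    unfolding B_def
  proof (rule sum_le_of_perturbed_recursion[where a = a and g = g and e = e and r = r])
    show "0 \<le> e k" "0 \<le> r k" for k using pos[of k] by (auto simp: e_def r_def)
    show "(\<Prod>k<n. 1 + e k) \<le> kappa_eps I \<epsilon>" "(\<Sum>k<n. e k) \<le> infsum \<epsilon> I" "(\<Sum>k<n. r k) \<le> infsum \<rho> I" for n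
      unfolding e_def r_def by (rule parameter_sums[OF parameters])+
    show "0 \<le> a k" for k by (simp add: a_def)
  qed (fact g0 step)+
  define h where "h N = real_of_ereal (?gap N)" for N
  have gap: "?gap N = ereal (h N) \<and> 0 \<le> h N \<and> h N \<le> B / (2 * real N)" if N: "N \<ge> 1" for N
  proof -
    have "?J (ergodic u N) \<le> ereal ((1 / real N) * (\<Sum>k<N. j + g k))"
      unfolding ergodic_def by (rule econvex_average[OF econvex_tilted _ N]) (simp add: g)
    also have "(1 / real N) * (\<Sum>k<N. j + g k) = j + (\<Sum>k<N. g k) / real N"
      using N by (simp add: sum.distrib field_simps)
    finally have le: "?J (ergodic u N) \<le> ereal (j + (\<Sum>k<N. g k) / real N)" .
    then obtain y where y: "?J (ergodic u N) = ereal y"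
      using j_le[of "ergodic u N"] by (cases "?J (ergodic u N)") auto
    have hN: "?gap N = ereal (y - j)" by (simp add: lagrangian_gap_def Phi_eq_tilted y j)
    have "y - j \<le> (\<Sum>k<N. g k) / real N" using le y by simp
    also have "\<dots> \<le> B / (2 * real N)" using sum_g[of N] N by (simp add: field_simps)
    finally show ?thesis using hN j_le[of "ergodic u N"] by (simp add: h_def y)
  qed
  have lim: "h \<longlonglongrightarrow> 0"
  proof (rule tendsto_sandwich)
    show "eventually (\<lambda>N. 0 \<le> h N) sequentially" "eventually (\<lambda>N. h N \<le> (B / 2) * (1 / real N)) sequentially"
      using gap by (auto intro!: eventually_sequentiallyI[of 1])
    show "(\<lambda>N. (B / 2) * (1 / real N)) \<longlonglongrightarrow> 0"
      by (rule tendsto_mult_right_zero[OF lim_1_over_n])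
  qed simp
  show ?thesis
  proof (intro conjI allI impI)
    fix N :: nat assume N: "N \<ge> 1"
    show "?gap N \<le> ereal ((infsum \<epsilon> I * kappa_eps I \<epsilon> + 1) / (2 * real N)
                * ((op_norm M (u 0 - u_hat))\<^sup>2 + infsum \<rho> I))"
      using gap[OF N] by (simp add: B_def a_def)
    show "\<bar>?gap N\<bar> \<noteq> \<infinity>" using gap[OF N] by auto
  next
    have "(\<lambda>N. ereal (h N)) \<longlonglongrightarrow> 0" using lim by (simp add: zero_ereal_def)
    moreover have "eventually (\<lambda>N. ereal (h N) = ?gap N) sequentially"
      using gap by (auto intro!: eventually_sequentiallyI[of 1])
    ultimately show "?gap \<longlonglongrightarrow> 0" by (rule Lim_transform_eventually)
  next
    show "(\<lambda>N. real_of_ereal (?gap N)) \<in> O(\<lambda>N. 1 / real N)"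
    proof (rule bigoI[of _ "B / 2"])
      show "eventually (\<lambda>N. norm (real_of_ereal (?gap N)) \<le> B / 2 * norm (1 / real N)) sequentially"
        using gap by (auto intro!: eventually_sequentiallyI[of 1])
    qed
  qed
qed

end
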